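(* There is an absolute constant $C\le 2^5$ such that the following holds. Let $H=H_0+q$, where $q$ is real-valued, integrable and compactly supported, and $H_0$ is as in one of Cases 1, 2, 3 of the context. In Case 1 let $\operatorname{supp} q\subset[0,\gamma]$ but in no smaller interval; in Cases 2 and 3 let $\gamma=\sup(\operatorname{supp} q)$. Let $(k_n)$ be the zeros, counted with multiplicity, of the entire function $F$ associated with the case. Then for every $p>1$, $$\sum_{\operatorname{Im}k_n\le 0}\frac1{|k_n-2i|^p}\le C\,Y_p\left(1+\frac{\gamma}{\pi}+\mathcal Q\right)\quad\text{and}\quad \sum_{\operatorname{Im}k_n\ge 0}\frac1{|k_n+2i|^p}\le C\,Y_p\left(1+\frac{\gamma}{\pi}+\mathcal Q\right),$$ where $Y_p=\sqrt\pi\,\Gamma\!\left(\frac{p-1}2\right)/\Gamma\!\left(\frac p2\right)$ and $$\mathcal Q=\begin{cases}\max\{\|q\|,\|q\|_1\} & \text{in Case 1},\\ 2\|q\|\max\{1,\gamma\} & \text{in Cases 2 and 3}.\end{cases}$$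
   Context: $H_0=-d^2/dx^2$ acts: in $L^2(\mathbb R)$ (Case 1); in $L^2(\mathbb R_+)$, $\mathbb R_+=[0,\infty)$, with the boundary condition $f(0)=0$ (Case 2); in $L^2(\mathbb R_+)$ with the boundary condition $f'(0)=0$ (Case 3). The potential $q$ is defined on $\mathbb R$ in Case 1 and on $\mathbb R_+$ in Cases 2 and 3. For $k\in\mathbb C\setminus\{0\}$ the equation $-f''+q(x)f=k^2f$ has unique solutions $\psi_\pm(x,k)$ such that $\psi_+(x,k)=e^{ikx}$ for large positive $x$ and (Case 1) $\psi_-(x,k)=e^{-ikx}$ for large negative $x$. For each $x$ the functions $\psi_\pm(x,\cdot)$, $\psi_\pm'(x,\cdot)$ (with $'=d/dx$) are (extend to) entire functions of $k$. The function $F$ is: in Case 1, $F(k)=w(k)=\{\psi_-(\cdot,k),\psi_+(\cdot,k)\}$, where $\{f,g\}=fg'-f'g$; in Case 2, $F(k)=\psi_+(0,k)$; in Case 3, $F(k)=\psi_+'(0,k)$. Zeros of $F$ in the open upper half-plane are $k_j=i|E_j|^{1/2}$ with $E_j<0$ the eigenvalues of $H$; zeros in the closed lower half-plane are called resonances of $H$. $\|q\|=\int|q(t)|\,dt$ and $\|q\|_1=\int|t\,q(t)|\,dt$, the integrals being over $\mathbb R$ (where $q$ on the half-line is extended by zero). *)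

theory Defs
  imports "HOL-Complex_Analysis.Complex_Analysis"
begin

text \<open>
  \<open>Line\<close>: $-d^2/dx^2$ on the real line.  \<open>Dirichlet\<close>, \<open>Neumann\<close>: $-d^2/dx^2$ on the half-line with
  $f(0) = 0$, respectively $f'(0) = 0$.
\<close>

datatype schroedinger_case = Line | Dirichlet | Neumann

fun domain :: "schroedinger_case \<Rightarrow> real set" where
  "domain Line = UNIV"
| "domain Dirichlet = {0..}"
| "domain Neumann = {0..}"

text \<open>One-sided at an end point of \<open>D\<close>.\<close>

definition deriv_on :: "real set \<Rightarrow> (real \<Rightarrow> complex) \<Rightarrow> real \<Rightarrow> complex" where
  "deriv_on D f x = vector_derivative f (at x within D)"

text \<open>
  The potential is only integrable, so a solution of $-f'' + qf = k^2 f$ on the interval \<open>D\<close> is a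
  differentiable \<open>f\<close> whose derivative is locally absolutely continuous, that is, an indefinite
  Lebesgue integral, with density $f'' = (q - k^2) f$.
\<close>

definition schroedinger_solution ::
    "real set \<Rightarrow> (real \<Rightarrow> real) \<Rightarrow> complex \<Rightarrow> (real \<Rightarrow> complex) \<Rightarrow> bool" where
  "schroedinger_solution D q k f \<longleftrightarrow>
     (\<forall>x\<in>D. f differentiable (at x within D)) \<and>
     (\<forall>a\<in>D. \<forall>b\<in>D. a \<le> b \<longrightarrow>
        set_integrable lebesgue {a..b} (\<lambda>t. (of_real (q t) - k\<^sup>2) * f t) \<and>
        deriv_on D f b - deriv_on D f a =
          (LINT t:{a..b}|lebesgue. (of_real (q t) - k\<^sup>2) * f t))"

definition jost_plus :: "real set \<Rightarrow> (real \<Rightarrow> real) \<Rightarrow> complex \<Rightarrow> (real \<Rightarrow> complex) \<Rightarrow> bool" where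
  "jost_plus D q k f \<longleftrightarrow> schroedinger_solution D q k f \<and>
     (\<forall>\<^sub>F x in at_top. f x = exp (\<i> * k * of_real x))"

definition jost_minus :: "real set \<Rightarrow> (real \<Rightarrow> real) \<Rightarrow> complex \<Rightarrow> (real \<Rightarrow> complex) \<Rightarrow> bool" where
  "jost_minus D q k f \<longleftrightarrow> schroedinger_solution D q k f \<and>
     (\<forall>\<^sub>F x in at_bot. f x = exp (- (\<i> * k * of_real x)))"

definition wronskian ::
    "real set \<Rightarrow> (real \<Rightarrow> complex) \<Rightarrow> (real \<Rightarrow> complex) \<Rightarrow> real \<Rightarrow> complex" where
  "wronskian D f g x = f x * deriv_on D g x - deriv_on D f x * g x"

text \<open>
  The value at \<open>k \<noteq> 0\<close> of the function whose zeros are the eigenvalue parameters and the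
  resonances.  The Wronskian of two solutions does not depend on \<open>x\<close>.
\<close>

fun jost_value :: "schroedinger_case \<Rightarrow> (real \<Rightarrow> real) \<Rightarrow> complex \<Rightarrow> complex \<Rightarrow> bool" where
  "jost_value Line q k v \<longleftrightarrow>
     (\<exists>\<psi>m \<psi>p. jost_minus UNIV q k \<psi>m \<and> jost_plus UNIV q k \<psi>p \<and> (\<forall>x. v = wronskian UNIV \<psi>m \<psi>p x))"
| "jost_value Dirichlet q k v \<longleftrightarrow> (\<exists>\<psi>p. jost_plus {0..} q k \<psi>p \<and> v = \<psi>p 0)"
| "jost_value Neumann q k v \<longleftrightarrow> (\<exists>\<psi>p. jost_plus {0..} q k \<psi>p \<and> v = deriv_on {0..} \<psi>p 0)"

text \<open>\<open>F\<close> is entire; its value at \<open>0\<close>, where the Jost solutions are not prescribed, is the one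
  determined by continuity.\<close>

definition jost_function :: "schroedinger_case \<Rightarrow> (real \<Rightarrow> real) \<Rightarrow> (complex \<Rightarrow> complex) \<Rightarrow> bool" where
  "jost_function c q F \<longleftrightarrow> F holomorphic_on UNIV \<and> (\<forall>k. k \<noteq> 0 \<longrightarrow> jost_value c q k (F k))"

text \<open>The support of the class of \<open>q\<close> modulo null sets.\<close>

definition ess_support :: "real set \<Rightarrow> (real \<Rightarrow> real) \<Rightarrow> real set" where
  "ess_support D q =
     {x \<in> D. \<forall>e>0. \<not> (AE t in lebesgue. t \<in> D \<and> \<bar>t - x\<bar> < e \<longrightarrow> q t = 0)}"

text \<open>
  For \<open>q = 0\<close> (almost everywhere) the support is empty and \<open>\<gamma> = 0\<close> in all cases: on the line because
  intervals are nonempty here, on the half-line because the supremum is taken in $[0,\infty)$.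
\<close>

fun support_bound :: "schroedinger_case \<Rightarrow> (real \<Rightarrow> real) \<Rightarrow> real \<Rightarrow> bool" where
  "support_bound Line q \<gamma> \<longleftrightarrow>
     0 \<le> \<gamma> \<and> ess_support UNIV q \<subseteq> {0..\<gamma>} \<and>
     \<not> (\<exists>a b. a \<le> b \<and> ess_support UNIV q \<subseteq> {a..b} \<and> {a..b} \<subset> {0..\<gamma>})"
| "support_bound Dirichlet q \<gamma> \<longleftrightarrow>
     \<gamma> = (if ess_support {0..} q = {} then 0 else Sup (ess_support {0..} q))"
| "support_bound Neumann q \<gamma> \<longleftrightarrow>
     \<gamma> = (if ess_support {0..} q = {} then 0 else Sup (ess_support {0..} q))"

definition norm_q :: "real set \<Rightarrow> (real \<Rightarrow> real) \<Rightarrow> real" where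
  "norm_q D q = (LINT t:D|lebesgue. \<bar>q t\<bar>)"

definition norm1_q :: "real set \<Rightarrow> (real \<Rightarrow> real) \<Rightarrow> real" where
  "norm1_q D q = (LINT t:D|lebesgue. \<bar>t * q t\<bar>)"

fun Q_const :: "schroedinger_case \<Rightarrow> (real \<Rightarrow> real) \<Rightarrow> real \<Rightarrow> real" where
  "Q_const Line q \<gamma> = max (norm_q UNIV q) (norm1_q UNIV q)"
| "Q_const Dirichlet q \<gamma> = 2 * norm_q {0..} q * max 1 \<gamma>"
| "Q_const Neumann q \<gamma> = 2 * norm_q {0..} q * max 1 \<gamma>"

definition Y_const :: "real \<Rightarrow> real" where
  "Y_const p = sqrt pi * Gamma ((p - 1) / 2) / Gamma (p / 2)"

text \<open>
  A sum over zeros counted with multiplicity is a sum over the set of zeros weighted by the order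
  of the zero.
\<close>

definition zero_sum_term :: "(complex \<Rightarrow> complex) \<Rightarrow> complex \<Rightarrow> real \<Rightarrow> complex \<Rightarrow> real" where
  "zero_sum_term F a p k = of_int (zorder F k) * (1 / norm (k - a) powr p)"

end

theory Submission
  imports Defs
begin

text \<open>
  The sum is controlled by counting zeros. If the number of zeros of \<open>F\<close> in the closed half-plane that
  lie within distance \<open>s\<close> of the pole $\pm 2i$ is at most \<open>A * s\<close> for all $s \ge 2$, then writing the sum
  as an integral over \<open>s\<close> bounds it by $A\,\frac{p}{p-1}\,2^{1-p} \le \frac32\,A/(p-1)$, and
  $Y_p \ge 2/(p-1)$ (\<open>sum_powr_le_of_linear_count\<close>, \<open>Y_const_ge\<close>). So it suffices to count with a
  constant \<open>A\<close> that is linear in \<open>\<gamma>\<close> and in the norm of \<open>q\<close>.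

  The count is a form of Jensen's inequality (\<open>zero_count_bound\<close>) centred at the real point \<open>k = 1\<close>.
  It needs an upper bound for $\log|F|$ on a circle of radius proportional to \<open>s\<close> and a lower bound for
  $\log|F(1)|$, both linear in \<open>\<gamma>\<close> and $\|q\|$. In all three cases $F(k)$ is a combination of the Cauchy
  data at \<open>0\<close> of the one solution $\psi_+$ (\<open>jost_value_cases\<close>), which is $e^{ikx}$ from \<open>\<gamma>\<close> on.

  The upper bound is Gronwall's inequality for the energy $|k||\psi_+| + |\psi_+'|$ on $[0,\gamma]$
  (\<open>jost_plus_energy_bound\<close>). The lower bound rests on \<open>q\<close> being real: for real \<open>k\<close> the flux
  $\mathrm{Im}(\overline{\psi_+}\,\psi_+')$ does not depend on \<open>x\<close> and equals \<open>k\<close> (\<open>flux_constant\<close>). At \<open>k = 1\<close>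
  the product $|\psi_+(0)||\psi_+'(0)|$ is therefore at least \<open>1\<close>; since neither factor exceeds
  $2e^{\gamma + \|q\|}$, neither is below $\frac12 e^{-\gamma-\|q\|}$, and on the line the flux bounds the Wronskian
  from below directly (\<open>jost_value_lower_bound\<close>). A centre high in the upper half-plane would have to avoid
  the eigenvalues and would be at a distance growing with \<open>q\<close>; a real centre costs only the factor
  $e^{\gamma+\|q\|}$.

  Since \<open>q\<close> is only integrable, the derivative of a solution is only absolutely continuous. The two facts
  about solutions are therefore proved from increments over short intervals rather than from pointwise
  differential inequalities.
\<close>

section \<open>Counting the zeros of an entire function\<close>

text \<open>
  Dividing an entire function by one of its zeros with full order does not change its order at the
  other points, so the zeros can be removed one at a time.
\<close>

lemma entire_divide_out_zeros:
  fixes F :: "complex \<Rightarrow> complex"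
  assumes holo: "F holomorphic_on UNIV" and nz: "F z0 \<noteq> 0" and "finite S"
  shows "\<exists>G. G holomorphic_on UNIV \<and> (\<forall>z. F z = (\<Prod>a\<in>S. (z - a) ^ nat (zorder F a)) * G z)"
  using \<open>finite S\<close>
proof induction
  case empty
  show ?case using holo by (intro exI[of _ F]) auto
next
  case (insert a S)
  define P where "P z = (\<Prod>b\<in>S. (z - b) ^ nat (zorder F b))" for z
  obtain G where G: "G holomorphic_on UNIV" and FG: "\<And>z. F z = P z * G z"
    using insert.IH by (auto simp: P_def)
  have "P holomorphic_on UNIV"
    unfolding P_def by (intro holomorphic_intros)
  moreover have "P a \<noteq> 0"
    using insert.hyps by (auto simp: P_def)
  moreover have "G z0 \<noteq> 0"
    using nz FG by auto
  then have "\<exists>w\<in>UNIV. G w \<noteq> 0" by blast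
  note G_order = zorder_exist_zero[OF G open_UNIV connected_UNIV UNIV_I this, of a]
  have pos: "zorder G a \<ge> 0"
    using conjunct1[OF G_order] by (simp split: if_splits)
  obtain r where r: "r > 0" "zor_poly G a holomorphic_on cball a r"
      "\<And>w. w \<in> cball a r \<Longrightarrow> G w = zor_poly G a w * (w - a) ^ nat (zorder G a) \<and> zor_poly G a w \<noteq> 0"
    using G_order by blast
  ultimately have zord: "zorder F a = zorder G a"
    using r pos FG
    by (intro zorder_eqI[of "ball a r" _ "\<lambda>w. P w * zor_poly G a w"])
       (auto intro!: holomorphic_on_mult intro: holomorphic_on_subset simp: power_int_def)
  define n where "n = nat (zorder G a)"
  \<comment> \<open>The quotient of \<open>G\<close> by $(z-a)^n$ has a removable singularity at \<open>a\<close>; the value that removes it is that of the local cofactor.\<close>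
  define H where "H z = (if z = a then zor_poly G a a else G z / (z - a) ^ n)" for z
  have GH: "G z = (z - a) ^ n * H z" for z
    using r(3)[of a] r(1) by (cases "z = a") (auto simp: H_def n_def)
  have "H holomorphic_on (UNIV - {a})"
  proof (rule holomorphic_transform)
    show "(\<lambda>z. G z / (z - a) ^ n) holomorphic_on (UNIV - {a})"
      by (intro holomorphic_intros holomorphic_on_subset[OF G]) auto
  qed (auto simp: H_def)
  moreover have "H holomorphic_on ball a r"
  proof (rule holomorphic_transform)
    show "zor_poly G a holomorphic_on ball a r"
      using r(2) by (rule holomorphic_on_subset) auto
    show "zor_poly G a z = H z" if "z \<in> ball a r" for z
      using r(3)[of z] that by (auto simp: H_def n_def)
  qed
  ultimately have "H holomorphic_on (UNIV - {a}) \<union> ball a r"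
    by (intro holomorphic_on_Un) auto
  moreover have "(UNIV - {a}) \<union> ball a r = UNIV"
    using r(1) by auto
  moreover have "F z = (\<Prod>b\<in>insert a S. (z - b) ^ nat (zorder F b)) * H z" for z
    using insert.hyps by (simp add: FG GH zord n_def P_def)
  ultimately have "H holomorphic_on UNIV"
      and "\<forall>z. F z = (\<Prod>b\<in>insert a S. (z - b) ^ nat (zorder F b)) * H z"
    by simp_all
  then show ?case by (intro exI[of _ H] conjI)
qed

text \<open>
  A weak form of Jensen's inequality. Divide \<open>F\<close> by the monic polynomial with the zeros in \<open>S\<close>. On the
  circle of radius \<open>R\<close> each linear factor has modulus at least \<open>R - r\<close>, at the centre at most \<open>r\<close>, and the
  maximum principle for the quotient compares the two.
\<close>

lemma zero_count_bound:
  fixes F :: "complex \<Rightarrow> complex"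
  assumes holo: "F holomorphic_on UNIV" and nz: "F z0 \<noteq> 0"
    and "finite S" and S: "S \<subseteq> cball z0 r" and r: "0 < r" "r < R"
    and M: "\<And>z. dist z0 z = R \<Longrightarrow> norm (F z) \<le> M"
  shows "((R - r) / r) ^ (\<Sum>a\<in>S. nat (zorder F a)) * norm (F z0) \<le> M"
proof -
  define n where "n = (\<Sum>a\<in>S. nat (zorder F a))"
  obtain G where G: "G holomorphic_on UNIV"
      and FG: "\<And>z. F z = (\<Prod>a\<in>S. (z - a) ^ nat (zorder F a)) * G z"
    using entire_divide_out_zeros[OF holo nz \<open>finite S\<close>] by auto
  have "norm (G z) \<le> M / (R - r) ^ n" if z: "dist z0 z = R" for z
  proof -
    have "(R - r) ^ n = (\<Prod>a\<in>S. (R - r) ^ nat (zorder F a))"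
      by (simp add: n_def power_sum)
    also have "\<dots> \<le> (\<Prod>a\<in>S. norm (z - a) ^ nat (zorder F a))"
    proof (intro prod_mono conjI power_mono)
      fix a assume "a \<in> S"
      then have "dist z0 a \<le> r" using S by auto
      then show "R - r \<le> norm (z - a)"
        using dist_triangle[of z0 z a] z by (simp add: dist_norm norm_minus_commute)
    qed (use r in auto)
    finally have "(R - r) ^ n * norm (G z) \<le> norm (F z)"
      by (simp add: FG norm_mult norm_power mult_right_mono flip: prod_norm)
    then show ?thesis using M[OF z] r by (simp add: field_simps)
  qed
  then have frontier: "norm (G z) \<le> M / (R - r) ^ n" if "z \<in> frontier (cball z0 R)" for z
    using that by simp
  have "G holomorphic_on interior (cball z0 R)" "continuous_on (closure (cball z0 R)) G"
    using holomorphic_on_subset[OF G] holomorphic_on_imp_continuous_on by blast+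
  then have Gz0: "norm (G z0) \<le> M / (R - r) ^ n"
    by (rule maximum_modulus_frontier[OF _ _ _ frontier]) (use r in auto)
  have "norm (F z0) = (\<Prod>a\<in>S. norm (z0 - a) ^ nat (zorder F a)) * norm (G z0)"
    by (simp add: FG norm_mult norm_power flip: prod_norm)
  also have "\<dots> \<le> (\<Prod>a\<in>S. r ^ nat (zorder F a)) * norm (G z0)"
    using S by (intro mult_right_mono prod_mono conjI power_mono) (auto simp: dist_norm)
  also have "\<dots> = r ^ n * norm (G z0)"
    by (simp add: n_def power_sum)
  also have "\<dots> \<le> r ^ n * (M / (R - r) ^ n)"
    using Gz0 r by (intro mult_left_mono) auto
  finally show ?thesis
    using r by (simp add: n_def[symmetric] field_simps power_divide)
qed

section \<open>Sums over sequences of linear growth\<close>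

text \<open>
  The layer cake formula: $d^{-p} = \int_d^\infty p\,s^{-p-1}\,ds$, and after interchanging the integral
  with the finite sum the integrand contains the number of points, with weights, at which $d \le s$.
\<close>

lemma sum_powr_le_of_linear_count:
  fixes d m :: "'a \<Rightarrow> real"
  assumes "finite S" and m: "\<And>k. k \<in> S \<Longrightarrow> m k \<ge> 0" and d: "\<And>k. k \<in> S \<Longrightarrow> d k \<ge> r"
    and count: "\<And>s. s \<ge> r \<Longrightarrow> (\<Sum>k | k \<in> S \<and> d k \<le> s. m k) \<le> A * s"
    and "r > 0" "p > 1"
  shows "(\<Sum>k\<in>S. m k * d k powr - p) \<le> A * (p / (p - 1)) * r powr (1 - p)"
proof -
  have single: "((\<lambda>s. if d k \<le> s then p * s powr (- p - 1) else 0) has_integral d k powr - p) {r..}"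
    if "k \<in> S" for k
  proof -
    have "((\<lambda>s. p * s powr (- p - 1)) has_integral p * (- (d k powr (- p - 1 + 1)) / (- p - 1 + 1))) {d k..}"
      using d[OF that] \<open>r > 0\<close> \<open>p > 1\<close> by (intro has_integral_mult_right has_integral_powr_to_inf) auto
    then have "((\<lambda>s. p * s powr (- p - 1)) has_integral d k powr - p) {d k..}"
      using \<open>p > 1\<close> by simp
    moreover have "{d k..} \<subseteq> {r..}" using d[OF that] by auto
    ultimately have "((\<lambda>s. if s \<in> {d k..} then p * s powr (- p - 1) else 0) has_integral d k powr - p) {r..}"
      by (simp only: has_integral_restrict)
    then show ?thesis by simp
  qed
  have "((\<lambda>s. \<Sum>k\<in>S. m k * (if d k \<le> s then p * s powr (- p - 1) else 0))
            has_integral (\<Sum>k\<in>S. m k * d k powr - p)) {r..}"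
    using \<open>finite S\<close> single by (intro has_integral_sum has_integral_mult_right) auto
  moreover have "((\<lambda>s. A * p * s powr - p) has_integral A * p * (- (r powr (- p + 1)) / (- p + 1))) {r..}"
    using \<open>r > 0\<close> \<open>p > 1\<close> by (intro has_integral_mult_right has_integral_powr_to_inf) auto
  ultimately have "(\<Sum>k\<in>S. m k * d k powr - p) \<le> A * p * (- (r powr (- p + 1)) / (- p + 1))"
  proof (rule has_integral_le)
    fix s assume "s \<in> {r..}"
    then have s: "s \<ge> r" "s > 0" using \<open>r > 0\<close> by auto
    have "(\<Sum>k\<in>S. m k * (if d k \<le> s then p * s powr (- p - 1) else 0))
        = (\<Sum>k | k \<in> S \<and> d k \<le> s. m k) * (p * s powr (- p - 1))"
      unfolding sum_distrib_right using \<open>finite S\<close>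
      by (intro sum.mono_neutral_cong_right) auto
    also have "\<dots> \<le> (A * s) * (p * s powr (- p - 1))"
      using s count[of s] \<open>p > 1\<close> by (intro mult_right_mono) auto
    also have "\<dots> = A * p * s powr - p"
      using s by (simp add: powr_diff)
    finally show "(\<Sum>k\<in>S. m k * (if d k \<le> s then p * s powr (- p - 1) else 0)) \<le> A * p * s powr - p" .
  qed
  also have "\<dots> = A * (p / (p - 1)) * r powr (1 - p)"
    using \<open>p > 1\<close> by (simp add: field_simps)
  finally show ?thesis .
qed

text \<open>
  \<open>Y_const p\<close> is the Beta value $B(t, \frac12)$ with $t = (p-1)/2$, and $B(t,\cdot)$ is decreasing, so that it
  is at least $B(t,1) = 1/t$. This is the blow-up as $p \to 1$ that the layer cake formula produces.
\<close>

lemma Y_const_ge: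
  assumes "p > 1"
  shows "2 / (p - 1) \<le> Y_const p"
proof -
  define t where "t = (p - 1) / 2"
  have t: "t > 0" using assms by (simp add: t_def)
  have "Beta t 1 \<le> Beta t (1/2)"
    using t by (intro Beta_real_mono) auto
  moreover have "Y_const p = Beta t (1/2)"
  proof -
    have *: "(p - 1) / 2 = t" "p / 2 = t + 1 / 2" by (simp_all add: t_def field_simps)
    show ?thesis
      unfolding Y_const_def Beta_def Gamma_one_half_real * by simp
  qed
  moreover have "Beta t 1 = 1 / t"
  proof -
    have "Gamma t \<noteq> 0" using Gamma_real_pos[OF t] by linarith
    moreover have "Gamma (t + 1) = t * Gamma t"
      using t by (intro Gamma_plus1) auto
    ultimately show ?thesis by (simp add: Beta_def)
  qed
  ultimately show ?thesis by (simp add: t_def)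
qed

text \<open>
  This absorbs what the layer cake formula leaves besides $1/(p-1)$, uniformly in \<open>p\<close>. Since
  $2^{p-1} \ge 1 + (p-1)\ln 2$ with $\ln 2 \ge \frac23$, the power grows at least as fast as $\frac23 p$.
\<close>

lemma power_factor_le:
  assumes "p > 1"
  shows "p * 2 powr (1 - p) \<le> (3/2::real)"
proof -
  have "2 powr (p - 1) = exp ((p - 1) * ln 2)"
    by (simp add: powr_def)
  also have "\<dots> \<ge> 1 + (p - 1) * ln (2::real)"
    by (rule exp_ge_add_one_self)
  finally have "2 powr (p - 1) \<ge> 1 + (p - 1) * ln (2::real)" .
  moreover have "ln (2::real) \<ge> 2/3"
    using ln2_ge_two_thirds by simp
  then have "(p - 1) * ln (2::real) \<ge> (p - 1) * (2/3)"
    using assms by (intro mult_left_mono) auto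
  moreover have "1 + (p - 1) * (2/3) \<ge> 2/3 * p"
    by (simp add: field_simps)
  ultimately have "p \<le> 3/2 * 2 powr (p - 1)" by argo
  then have "p * 2 powr (1 - p) \<le> 3/2 * 2 powr (p - 1) * 2 powr (1 - p)"
    by (intro mult_right_mono) auto
  also have "\<dots> = 3/2 * 2 powr ((p - 1) + (1 - p))"
    by (simp only: powr_add mult.assoc)
  finally show ?thesis by simp
qed

section \<open>Integral inequalities with a monotone majorant\<close>

text \<open>
  Gronwall's inequality with the integral of the coefficient replaced by a continuous monotone \<open>V\<close>. No
  derivative of \<open>V\<close> is available when the coefficient is only integrable, so the interval is cut into
  \<open>n\<close> pieces on each of which \<open>V\<close> grows by the same amount $e = T/n$. Crossing one piece costs a factor
  $1/(1-e)$, and $(1 - T/n)^{-n} \to e^T$.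
\<close>

lemma gronwall_one_sided:
  fixes N V :: "real \<Rightarrow> real"
  assumes ab: "a \<le> b" and cN: "continuous_on {a..b} N" and cV: "continuous_on {a..b} V"
    and N0: "\<And>x. x \<in> {a..b} \<Longrightarrow> 0 \<le> N x"
    and V: "\<And>x y. a \<le> x \<Longrightarrow> x \<le> y \<Longrightarrow> y \<le> b \<Longrightarrow> V x \<le> V y"
    and step: "\<And>x y B. a \<le> x \<Longrightarrow> x \<le> y \<Longrightarrow> y \<le> b \<Longrightarrow> (\<And>t. t \<in> {x..y} \<Longrightarrow> N t \<le> B)
                 \<Longrightarrow> N x - N y \<le> B * (V y - V x)"
  shows "N a \<le> N b * exp (V b - V a)"
proof -
  have short: "N x * (1 - e) \<le> N y"
    if xy: "a \<le> x" "x \<le> y" "y \<le> b" and e: "V y - V x \<le> e" "e \<le> 1" for x y e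
  proof -
    have "continuous_on {x..y} N" using cN by (rule continuous_on_subset) (use xy in auto)
    \<comment> \<open>The hypothesis is used on the part to the right of a maximum point \<open>t\<close>, with the maximum as the bound.\<close>
    then obtain t where t: "t \<in> {x..y}" and max: "\<And>s. s \<in> {x..y} \<Longrightarrow> N s \<le> N t"
      using continuous_attains_sup[of "{x..y}" N] xy by auto
    have "N t - N y \<le> N t * (V y - V t)"
      using t xy max by (intro step) auto
    also have "\<dots> \<le> N t * e"
    proof (rule mult_left_mono)
      show "V y - V t \<le> e" using V[of x t] t xy e by auto
      show "0 \<le> N t" using N0[of t] t xy by auto
    qed
    finally have "N t * (1 - e) \<le> N y" by (simp add: algebra_simps)
    moreover have "N x * (1 - e) \<le> N t * (1 - e)"
      using max[of x] xy e by (intro mult_right_mono) auto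
    ultimately show ?thesis by linarith
  qed
  have iter: "N x * (1 - e) ^ n \<le> N b"
    if "a \<le> x" "x \<le> b" "V b - V x \<le> real n * e" "0 \<le> e" "e \<le> 1" for x n e
    using that
  proof (induction n arbitrary: x)
    case 0
    then show ?case using short[of x b 0] by simp
  next
    case (Suc n)
    show ?case
    proof (cases "V b - V x \<le> e")
      case True
      have "N x * (1 - e) ^ Suc n \<le> N x * (1 - e) * 1"
        unfolding power_Suc mult.assoc[symmetric] using Suc.prems N0[of x]
        by (intro mult_left_mono power_le_one) auto
      also have "\<dots> \<le> N b" using short[of x b e] True Suc.prems by simp
      finally show ?thesis .
    next
      case False
      have "continuous_on {x..b} V" using cV by (rule continuous_on_subset) (use Suc.prems in auto)
      then obtain y where y: "x \<le> y" "y \<le> b" "V y = V x + e"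
        using IVT'[of V x "V x + e" b] Suc.prems False by auto
      have "N x * (1 - e) * (1 - e) ^ n \<le> N y * (1 - e) ^ n"
        using short[of x y e] y Suc.prems by (intro mult_right_mono) auto
      also have "\<dots> \<le> N b"
        using y Suc.prems by (intro Suc.IH) (auto simp: algebra_simps)
      finally show ?thesis by (simp add: mult.assoc)
    qed
  qed
  define T where "T = V b - V a"
  have T0: "0 \<le> T" using V[of a b] ab by (simp add: T_def)
  have "(\<lambda>n. N a * (1 + (- T) / real n) ^ n) \<longlonglongrightarrow> N a * exp (- T)"
    by (intro tendsto_intros tendsto_exp_limit_sequentially)
  moreover have "\<forall>\<^sub>F n in sequentially. N a * (1 + (- T) / real n) ^ n \<le> N b"
    using eventually_gt_at_top[of "nat \<lceil>T\<rceil>"]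
  proof eventually_elim
    case (elim n)
    then have n: "real n > 0" "T \<le> real n" by linarith+
    have "N a * (1 - T / real n) ^ n \<le> N b"
      using iter[of a n "T / real n"] n T0 ab by (simp add: T_def)
    then show ?case by simp
  qed
  ultimately have "N a * exp (- T) \<le> N b"
    by (rule tendsto_upperbound) simp
  then show ?thesis by (simp add: T_def exp_minus field_simps exp_diff)
qed

text \<open>
  The second bound is the first one for the reflected functions \<open>\<lambda>x. N (- x)\<close> and \<open>\<lambda>x. - V (- x)\<close>.
\<close>

lemma gronwall:
  fixes N V :: "real \<Rightarrow> real"
  assumes ab: "a \<le> b" and cN: "continuous_on {a..b} N" and cV: "continuous_on {a..b} V"
    and N0: "\<And>x. x \<in> {a..b} \<Longrightarrow> 0 \<le> N x"
    and V: "\<And>x y. a \<le> x \<Longrightarrow> x \<le> y \<Longrightarrow> y \<le> b \<Longrightarrow> V x \<le> V y"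
    and step: "\<And>x y B. a \<le> x \<Longrightarrow> x \<le> y \<Longrightarrow> y \<le> b \<Longrightarrow> (\<And>t. t \<in> {x..y} \<Longrightarrow> N t \<le> B)
                 \<Longrightarrow> \<bar>N x - N y\<bar> \<le> B * (V y - V x)"
  shows "N a \<le> N b * exp (V b - V a)" and "N b \<le> N a * exp (V b - V a)"
proof -
  show "N a \<le> N b * exp (V b - V a)"
    by (rule gronwall_one_sided[OF ab cN cV N0 V]) (use step in \<open>force simp: abs_le_iff\<close>)+
  have "N (- (- b)) \<le> N (- (- a)) * exp (- V (- (- a)) - - V (- (- b)))"
  proof (rule gronwall_one_sided[where a = "- b" and b = "- a" and N = "\<lambda>x. N (- x)" and V = "\<lambda>x. - V (- x)"])
    show "continuous_on {- b..- a} (\<lambda>x. N (- x))" "continuous_on {- b..- a} (\<lambda>x. - V (- x))"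
      by (intro continuous_intros continuous_on_compose2[OF cN] continuous_on_compose2[OF cV]; force)+
    show "N (- x) - N (- y) \<le> B * (- V (- y) - - V (- x))"
      if "- b \<le> x" "x \<le> y" "y \<le> - a" and B: "\<And>t. t \<in> {x..y} \<Longrightarrow> N (- t) \<le> B" for x y B
    proof -
      have "N t \<le> B" if "t \<in> {- y..- x}" for t
        using B[of "- t"] that by auto
      then have "\<bar>N (- y) - N (- x)\<bar> \<le> B * (V (- x) - V (- y))"
        using that by (intro step) auto
      then show ?thesis by (simp add: algebra_simps)
    qed
  qed (use ab N0 V in auto)
  then show "N b \<le> N a * exp (V b - V a)" by simp
qed

text \<open>
  The difference quotient of \<open>\<Phi>\<close> is at most the increment of the continuous \<open>W\<close>, so the derivative of
  \<open>\<Phi>\<close> vanishes everywhere. This replaces the product rule for functions whose second factor is only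
  absolutely continuous.
\<close>

lemma constant_if_small_increments:
  fixes \<Phi> W :: "real \<Rightarrow> real"
  assumes ab: "a \<le> b" and cW: "continuous_on {a..b} W"
    and inc: "\<And>x y. a \<le> x \<Longrightarrow> x \<le> y \<Longrightarrow> y \<le> b \<Longrightarrow> \<bar>\<Phi> y - \<Phi> x\<bar> \<le> (y - x) * (W y - W x)"
  shows "\<Phi> a = \<Phi> b"
proof -
  have "(\<Phi> has_field_derivative 0) (at x within {a..b})" if x: "x \<in> {a..b}" for x
  proof -
    have "((\<lambda>y. \<bar>W y - W x\<bar>) \<longlongrightarrow> \<bar>W x - W x\<bar>) (at x within {a..b})"
      using cW x by (intro tendsto_intros) (auto simp: continuous_on)
    then have lim: "((\<lambda>y. \<bar>W y - W x\<bar>) \<longlongrightarrow> 0) (at x within {a..b})"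
      by simp
    have "norm ((\<Phi> y - \<Phi> x) / (y - x)) \<le> \<bar>W y - W x\<bar>" if y: "y \<in> {a..b}" "y \<noteq> x" for y
    proof (cases "x \<le> y")
      case True
      then have "(y - x) * (W y - W x) \<le> (y - x) * \<bar>W y - W x\<bar>"
        by (intro mult_left_mono) auto
      then show ?thesis
        using inc[of x y] x y True by (auto simp: divide_le_eq mult.commute intro: order_trans)
    next
      case False
      then have "(x - y) * (W x - W y) \<le> (x - y) * \<bar>W y - W x\<bar>"
        by (intro mult_left_mono) auto
      then show ?thesis
        using inc[of y x] x y False
        by (auto simp: divide_le_eq mult.commute abs_minus_commute intro: order_trans)
    qed
    then have "\<forall>\<^sub>F y in at x within {a..b}. norm ((\<Phi> y - \<Phi> x) / (y - x)) \<le> \<bar>W y - W x\<bar>"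
      by (auto simp: eventually_at_filter)
    then show ?thesis
      unfolding has_field_derivative_iff using lim by (rule Lim_null_comparison)
  qed
  then obtain c where "\<And>x. x \<in> {a..b} \<Longrightarrow> \<Phi> x = c"
    using has_field_derivative_zero_constant[of "{a..b}" \<Phi>] by (auto simp: convex_real_interval)
  then show ?thesis using ab by simp
qed

section \<open>Weak solutions on a compact interval\<close>

text \<open>
  A solution \<open>f\<close> on a compact interval together with its derivative \<open>g\<close>, with the equation integrated once
  and expressed by the gauge integral. Keeping \<open>g\<close> as a separate argument makes the notion linear in the
  pair, whatever the domain on which the derivative was taken.
\<close>

definition weak_solution ::
    "(real \<Rightarrow> real) \<Rightarrow> complex \<Rightarrow> real \<Rightarrow> real \<Rightarrow> (real \<Rightarrow> complex) \<Rightarrow> (real \<Rightarrow> complex) \<Rightarrow> bool" where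
  "weak_solution q k a b f g \<longleftrightarrow>
     (\<forall>x\<in>{a..b}. (f has_vector_derivative g x) (at x within {a..b})) \<and>
     (\<forall>x y. a \<le> x \<longrightarrow> x \<le> y \<longrightarrow> y \<le> b \<longrightarrow>
        ((\<lambda>t. (of_real (q t) - k\<^sup>2) * f t) has_integral (g y - g x)) {x..y})"

lemma weak_solution_deriv:
  "weak_solution q k a b f g \<Longrightarrow> x \<in> {a..b} \<Longrightarrow> (f has_vector_derivative g x) (at x within {a..b})"
  by (simp add: weak_solution_def)

lemma weak_solution_integral:
  "weak_solution q k a b f g \<Longrightarrow> a \<le> x \<Longrightarrow> x \<le> y \<Longrightarrow> y \<le> b
    \<Longrightarrow> ((\<lambda>t. (of_real (q t) - k\<^sup>2) * f t) has_integral (g y - g x)) {x..y}"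
  by (simp add: weak_solution_def)

lemma weak_solution_continuous:
  assumes sol: "weak_solution q k a b f g" and ab: "a \<le> b"
  shows "continuous_on {a..b} f" "continuous_on {a..b} g"
proof -
  show "continuous_on {a..b} f"
    unfolding continuous_on_eq_continuous_within
    using weak_solution_deriv[OF sol] has_vector_derivative_continuous by blast
  define h where "h t = (of_real (q t) - k\<^sup>2) * f t" for t
  have "h integrable_on {a..b}"
    using weak_solution_integral[OF sol order.refl ab order.refl] unfolding h_def by blast
  then have "continuous_on {a..b} (\<lambda>x. g a + integral {a..x} h)"
    by (intro continuous_intros indefinite_integral_continuous_1)
  moreover have "g a + integral {a..x} h = g x" if "x \<in> {a..b}" for x
    using integral_unique[OF weak_solution_integral[OF sol, of a x]] that unfolding h_def by simp
  ultimately show "continuous_on {a..b} g"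
    by (rule continuous_on_eq)
qed

lemma weak_solution_deriv_integral:
  assumes sol: "weak_solution q k a b f g" and "a \<le> x" "x \<le> y" "y \<le> b"
  shows "(g has_integral (f y - f x)) {x..y}"
  using assms(2-)
  by (intro fundamental_theorem_of_calculus has_vector_derivative_within_subset[OF weak_solution_deriv[OF sol]]) auto

text \<open>
  The energy $|k||f| + |f'|$ has coefficient $|k| + |q|/|k|$ in its integral inequality:
  $|k||f|' \le |k||f'|$ and $|f''| \le |k|^2|f| + |q||f|$ with $|f|$ at most the energy divided by $|k|$.
  Adding the two densities before estimating them keeps the coefficient of $|k|$ equal to \<open>1\<close>.
\<close>

lemma weak_solution_energy_increment:
  assumes sol: "weak_solution q k a b f g" and k: "k \<noteq> 0"
    and q: "(\<lambda>t. \<bar>q t\<bar>) integrable_on {a..b}"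
    and xy: "a \<le> x" "x \<le> y" "y \<le> b"
    and B: "\<And>t. t \<in> {x..y} \<Longrightarrow> cmod k * cmod (f t) + cmod (g t) \<le> B"
  shows "\<bar>(cmod k * cmod (f x) + cmod (g x)) - (cmod k * cmod (f y) + cmod (g y))\<bar>
     \<le> B * ((cmod k * y + integral {a..y} (\<lambda>t. \<bar>q t\<bar>) / cmod k) - (cmod k * x + integral {a..x} (\<lambda>t. \<bar>q t\<bar>) / cmod k))"
proof -
  have cont: "continuous_on {x..y} f" "continuous_on {x..y} g"
    using weak_solution_continuous[OF sol] xy by (auto intro: continuous_on_subset)
  have qxy: "(\<lambda>t. \<bar>q t\<bar>) integrable_on {x..y}"
    using q by (rule integrable_on_subinterval) (use xy in auto)
  \<comment> \<open>\<open>P\<close> and \<open>R\<close> dominate the densities of $k f$ and of $f'$. In \<open>R\<close> only the term with \<open>q\<close> is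
      estimated by \<open>B\<close> at once, so that no integrability of $|q||f|$ has to be proved.\<close>
  define P where "P t = cmod k * cmod (g t)" for t
  define R where "R t = \<bar>q t\<bar> * (B / cmod k) + (cmod k)\<^sup>2 * cmod (f t)" for t
  have iP: "P integrable_on {x..y}"
    unfolding P_def by (intro integrable_continuous_interval continuous_intros cont)
  have iR: "R integrable_on {x..y}"
    unfolding R_def
    by (intro integrable_add integrable_on_mult_left qxy integrable_continuous_interval continuous_intros cont)
  have gi: "(\<lambda>t. k * g t) integrable_on {x..y}"
    by (intro integrable_continuous_interval continuous_intros cont)
  have "((\<lambda>t. k * g t) has_integral k * (f y - f x)) {x..y}"
    by (intro has_integral_mult_right weak_solution_deriv_integral[OF sol] xy)
  then have "integral {x..y} (\<lambda>t. k * g t) = k * (f y - f x)"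
    by (rule integral_unique)
  then have "cmod (k * (f y - f x)) \<le> integral {x..y} P"
    using integral_norm_bound_integral[OF gi iP] by (metis P_def norm_mult order.refl)
  moreover have "cmod (g y - g x) \<le> integral {x..y} R"
  proof -
    have hi: "((\<lambda>t. (of_real (q t) - k\<^sup>2) * f t) has_integral (g y - g x)) {x..y}"
      using sol xy by (rule weak_solution_integral)
    have "cmod ((of_real (q t) - k\<^sup>2) * f t) \<le> R t" if "t \<in> {x..y}" for t
    proof -
      have "cmod k * cmod (f t) \<le> B" using B[OF that] norm_ge_zero[of "g t"] by linarith
      then have "cmod (f t) \<le> B / cmod k" using k by (simp add: field_simps)
      then have "\<bar>q t\<bar> * cmod (f t) \<le> \<bar>q t\<bar> * (B / cmod k)" by (intro mult_left_mono) auto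
      moreover have "cmod ((of_real (q t) - k\<^sup>2) * f t) \<le> (\<bar>q t\<bar> + (cmod k)\<^sup>2) * cmod (f t)"
        unfolding norm_mult using norm_triangle_ineq4[of "of_real (q t)" "k\<^sup>2"]
        by (intro mult_right_mono) (auto simp: norm_power)
      ultimately show ?thesis by (simp add: R_def algebra_simps)
    qed
    from integral_norm_bound_integral[OF has_integral_integrable[OF hi] iR this] hi
    show ?thesis by (simp add: integral_unique)
  qed
  moreover have "integral {x..y} P + integral {x..y} R \<le> B * (cmod k * (y - x) + integral {x..y} (\<lambda>t. \<bar>q t\<bar>) / cmod k)"
  proof -
    have "integral {x..y} P + integral {x..y} R = integral {x..y} (\<lambda>t. P t + R t)"
      using iP iR by (simp add: integral_add)
    also have "\<dots> \<le> integral {x..y} (\<lambda>t. cmod k * B + \<bar>q t\<bar> * (B / cmod k))"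
    proof (rule integral_le)
      show "(\<lambda>t. P t + R t) integrable_on {x..y}" using iP iR by (rule integrable_add)
      show "(\<lambda>t. cmod k * B + \<bar>q t\<bar> * (B / cmod k)) integrable_on {x..y}"
        by (intro integrable_add integrable_on_mult_left qxy integrable_const_ivl)
      show "P t + R t \<le> cmod k * B + \<bar>q t\<bar> * (B / cmod k)" if "t \<in> {x..y}" for t
        using mult_left_mono[OF B[OF that], of "cmod k"]
        by (simp add: P_def R_def algebra_simps power2_eq_square)
    qed
    also have "\<dots> = cmod k * B * (y - x) + integral {x..y} (\<lambda>t. \<bar>q t\<bar>) * (B / cmod k)"
      using xy integral_add[OF integrable_const_ivl[of "cmod k * B" x y] integrable_on_mult_left[OF qxy, of "B / cmod k"]]
      by (simp only: integral_mult_left integral_const_real) (simp add: mult.commute)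
    finally show ?thesis by (simp add: algebra_simps)
  qed
  moreover have "integral {x..y} (\<lambda>t. \<bar>q t\<bar>) = integral {a..y} (\<lambda>t. \<bar>q t\<bar>) - integral {a..x} (\<lambda>t. \<bar>q t\<bar>)"
    unfolding eq_diff_eq add.commute[of "integral {x..y} _"]
    using xy by (intro Henstock_Kurzweil_Integration.integral_combine integrable_on_subinterval[OF q]) auto
  moreover have "\<bar>(cmod k * cmod (f x) + cmod (g x)) - (cmod k * cmod (f y) + cmod (g y))\<bar>
      \<le> cmod (k * (f y - f x)) + cmod (g y - g x)"
    using norm_triangle_ineq3[of "k * f y" "k * f x"] norm_triangle_ineq3[of "g y" "g x"]
    by (simp add: norm_mult right_diff_distrib)
  ultimately have "\<bar>(cmod k * cmod (f x) + cmod (g x)) - (cmod k * cmod (f y) + cmod (g y))\<bar>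
      \<le> B * (cmod k * (y - x) + (integral {a..y} (\<lambda>t. \<bar>q t\<bar>) - integral {a..x} (\<lambda>t. \<bar>q t\<bar>)) / cmod k)"
    by simp
  then show ?thesis
    by (simp add: algebra_simps diff_divide_distrib)
qed

lemma weak_solution_energy_growth:
  assumes sol: "weak_solution q k a b f g" and k: "k \<noteq> 0" and ab: "a \<le> b"
    and q: "(\<lambda>t. \<bar>q t\<bar>) integrable_on {a..b}"
  defines "E \<equiv> \<lambda>t. cmod k * cmod (f t) + cmod (g t)"
    and "G \<equiv> exp (cmod k * (b - a) + integral {a..b} (\<lambda>t. \<bar>q t\<bar>) / cmod k)"
  shows "E a \<le> E b * G" "E b \<le> E a * G"
proof -
  define V where "V t = cmod k * t + integral {a..t} (\<lambda>t. \<bar>q t\<bar>) / cmod k" for t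
  have cE: "continuous_on {a..b} E"
    unfolding E_def by (intro continuous_intros weak_solution_continuous[OF sol ab])
  have cV: "continuous_on {a..b} V"
    unfolding V_def using k by (intro continuous_intros indefinite_integral_continuous_1 q) auto
  have V_mono: "V x \<le> V y" if "a \<le> x" "x \<le> y" "y \<le> b" for x y
    unfolding V_def using that
    by (intro add_mono mult_left_mono divide_right_mono integral_subset_le integrable_on_subinterval[OF q]) auto
  have step: "\<bar>E x - E y\<bar> \<le> B * (V y - V x)"
    if "a \<le> x" "x \<le> y" "y \<le> b" "\<And>t. t \<in> {x..y} \<Longrightarrow> E t \<le> B" for x y B
    using weak_solution_energy_increment[OF sol k q that(1-3), of B] that(4) by (simp add: E_def V_def)
  have E0: "0 \<le> E x" for x by (simp add: E_def)
  have G: "G = exp (V b - V a)"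
    by (simp add: G_def V_def algebra_simps)
  show "E a \<le> E b * G" "E b \<le> E a * G"
    unfolding G using gronwall[where N = E and V = V, OF ab cE cV E0 V_mono step] by blast+
qed

lemma weak_solution_diff:
  assumes "weak_solution q k a b f1 g1" "weak_solution q k a b f2 g2"
  shows "weak_solution q k a b (\<lambda>x. f1 x - f2 x) (\<lambda>x. g1 x - g2 x)"
proof -
  have "((\<lambda>t. (of_real (q t) - k\<^sup>2) * (f1 t - f2 t)) has_integral (g1 y - g2 y - (g1 x - g2 x))) {x..y}"
    if "a \<le> x" "x \<le> y" "y \<le> b" for x y
    using has_integral_diff[OF assms[THEN weak_solution_integral, OF that]]
    by (simp only: right_diff_distrib) (simp add: algebra_simps)
  then show ?thesis
    using assms by (auto simp: weak_solution_def intro: has_vector_derivative_diff)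
qed

lemma weak_solution_exp:
  fixes k \<sigma> :: complex
  assumes "\<sigma>\<^sup>2 = - k\<^sup>2"
  shows "weak_solution (\<lambda>_. 0) k a b (\<lambda>x. exp (\<sigma> * of_real x)) (\<lambda>x. \<sigma> * exp (\<sigma> * of_real x))"
proof -
  have exp_deriv: "((\<lambda>x. exp (\<sigma> * of_real x)) has_vector_derivative \<sigma> * exp (\<sigma> * of_real x)) (at x within A)" for x A
    by (rule has_vector_derivative_real_field) (auto intro!: derivative_eq_intros)
  have "((\<lambda>t. (0 - k\<^sup>2) * exp (\<sigma> * of_real t)) has_integral
          (\<sigma> * exp (\<sigma> * of_real y) - \<sigma> * exp (\<sigma> * of_real x))) {x..y}" if "x \<le> y" for x y
  proof (rule fundamental_theorem_of_calculus[OF that])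
    show "((\<lambda>t. \<sigma> * exp (\<sigma> * of_real t)) has_vector_derivative (0 - k\<^sup>2) * exp (\<sigma> * of_real t)) (at t within {x..y})" for t
      using has_vector_derivative_mult_right[OF exp_deriv[of t "{x..y}"], of \<sigma>] assms
      by (simp add: power2_eq_square flip: mult.assoc)
  qed
  then show ?thesis using exp_deriv by (simp add: weak_solution_def)
qed

lemma weak_solution_free:
  assumes sol: "weak_solution q k a b f g" and null: "negligible {t \<in> {a..b}. q t \<noteq> 0}"
  shows "weak_solution (\<lambda>_. 0) k a b f g"
proof -
  have "((\<lambda>t. (of_real 0 - k\<^sup>2) * f t) has_integral (g y - g x)) {x..y}"
    if "a \<le> x" "x \<le> y" "y \<le> b" for x y
    by (rule has_integral_spike[OF null _ weak_solution_integral[OF sol that]]) (use that in auto)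
  then show ?thesis using sol by (auto simp: weak_solution_def)
qed

text \<open>
  Where the potential vanishes almost everywhere, a solution with the Cauchy data of an exponential at
  one end of the interval is that exponential: the difference has energy zero there, hence at the other
  end too.
\<close>

lemma free_solution_unique:
  fixes k \<sigma> :: complex
  assumes sol: "weak_solution q k a b f g" and null: "negligible {t \<in> {a..b}. q t \<noteq> 0}"
    and k: "k \<noteq> 0" and ab: "a \<le> b" and \<sigma>: "\<sigma>\<^sup>2 = - k\<^sup>2"
    and c: "c \<in> {a, b}" "f c = exp (\<sigma> * of_real c)" "g c = \<sigma> * exp (\<sigma> * of_real c)"
    and d: "d \<in> {a, b}"
  shows "f d = exp (\<sigma> * of_real d)" "g d = \<sigma> * exp (\<sigma> * of_real d)"
proof -
  define f0 where "f0 x = f x - exp (\<sigma> * of_real x)" for x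
  define g0 where "g0 x = g x - \<sigma> * exp (\<sigma> * of_real x)" for x
  have "weak_solution (\<lambda>_. 0) k a b f0 g0"
    unfolding f0_def g0_def using weak_solution_diff[OF weak_solution_free[OF sol null] weak_solution_exp[OF \<sigma>]] .
  from weak_solution_energy_growth[OF this k ab]
  have "cmod k * cmod (f0 d) + cmod (g0 d)
      \<le> (cmod k * cmod (f0 c) + cmod (g0 c)) * exp (cmod k * (b - a))"
    using c(1) d mult_left_mono[of 1 "exp (cmod k * (b - a))" "cmod k * cmod (f0 d) + cmod (g0 d)"] ab
    by (auto simp: integrable_0)
  also have "\<dots> = 0" using c by (simp add: f0_def g0_def)
  finally have "cmod k * cmod (f0 d) + cmod (g0 d) = 0"
    by (intro antisym) auto
  then have "cmod k * cmod (f0 d) = 0" "cmod (g0 d) = 0"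
    by (smt (verit) mult_nonneg_nonneg norm_ge_zero)+
  then show "f d = exp (\<sigma> * of_real d)" "g d = \<sigma> * exp (\<sigma> * of_real d)"
    using k by (simp_all add: f0_def g0_def)
qed

text \<open>
  The flux $\mathrm{Im}(\overline f f')$ is half the Wronskian of $\overline f$ and $f$, up to the factor \<open>\<i>\<close>,
  and both solve the same equation because \<open>q\<close> and $k^2$ are real. Over a short interval the two terms of
  the increment of the flux are of second order: $\mathrm{Im}(\overline{f(y)} f(t))$ is small because it
  vanishes at $t = y$, and $\mathrm{Im}(\overline{g(t)} g(x))$ because it vanishes at $t = x$.
\<close>

lemma flux_constant:
  fixes \<kappa> :: real
  assumes sol: "weak_solution q (of_real \<kappa>) a b f g" and ab: "a \<le> b"
    and q: "(\<lambda>t. \<bar>q t\<bar>) integrable_on {a..b}"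
  shows "Im (cnj (f a) * g a) = Im (cnj (f b) * g b)"
proof -
  have cont: "continuous_on {a..b} f" "continuous_on {a..b} g"
    using weak_solution_continuous[OF sol ab] by auto
  have "compact (f ` {a..b})" "compact (g ` {a..b})"
    by (intro compact_continuous_image cont compact_Icc)+
  then have "bounded (f ` {a..b})" "bounded (g ` {a..b})"
    by (simp_all add: compact_imp_bounded)
  then obtain B1 B2 where B12: "\<And>t. t \<in> {a..b} \<Longrightarrow> cmod (f t) \<le> B1" "\<And>t. t \<in> {a..b} \<Longrightarrow> cmod (g t) \<le> B2"
    unfolding bounded_iff ball_simps(9) by blast
  define B where "B = max 1 (max B1 B2)"
  have B: "0 < B" "\<And>t. t \<in> {a..b} \<Longrightarrow> cmod (f t) \<le> B" "\<And>t. t \<in> {a..b} \<Longrightarrow> cmod (g t) \<le> B"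
    unfolding B_def using B12 by (auto intro: order_trans simp: le_max_iff_disj)
  define w where "w t = \<bar>q t\<bar> + \<kappa>\<^sup>2" for t
  define W where "W x = 2 * B\<^sup>2 * integral {a..x} w" for x
  have iw: "w integrable_on {a..b}"
    unfolding w_def by (intro integrable_add q integrable_const_ivl)
  show ?thesis
  proof (rule constant_if_small_increments[where \<Phi> = "\<lambda>x. Im (cnj (f x) * g x)" and W = W, OF ab])
    show "continuous_on {a..b} W"
      unfolding W_def by (intro continuous_intros indefinite_integral_continuous_1 iw)
  next
    fix x y assume xy: "a \<le> x" "x \<le> y" "y \<le> b"
    define I where "I = integral {x..y} w"
    have iwxy: "w integrable_on {x..y}"
      using iw by (rule integrable_on_subinterval) (use xy in auto)
    have wI: "(w has_integral I) {x..y}"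
      unfolding I_def using iwxy by (rule integrable_integral)
    have w0: "0 \<le> w t" for t by (simp add: w_def)
    have W_diff: "W y - W x = 2 * B\<^sup>2 * I"
    proof -
      have "integral {a..y} w = integral {a..x} w + I"
        unfolding I_def using xy
        by (intro Henstock_Kurzweil_Integration.integral_combine[symmetric] integrable_on_subinterval[OF iw]) auto
      then show ?thesis by (simp add: W_def distrib_left)
    qed
    have g_inc: "cmod (g t - g s) \<le> B * I" if "x \<le> s" "s \<le> t" "t \<le> y" for s t
    proof -
      have hi: "((\<lambda>t. (of_real (q t) - (of_real \<kappa>)\<^sup>2) * f t) has_integral (g t - g s)) {s..t}"
        using that xy by (intro weak_solution_integral[OF sol]) auto
      have wi: "w integrable_on {s..t}"
        using iwxy by (rule integrable_on_subinterval) (use that in auto)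
      have "cmod (g t - g s) \<le> integral {s..t} (\<lambda>t. B * w t)"
        unfolding integral_unique[OF hi, symmetric]
      proof (rule integral_norm_bound_integral)
        show "(\<lambda>t. B * w t) integrable_on {s..t}" using wi by (rule integrable_on_mult_right)
        show "cmod ((of_real (q u) - (of_real \<kappa>)\<^sup>2) * f u) \<le> B * w u" if "u \<in> {s..t}" for u
        proof -
          have "cmod (of_real (q u) - (of_real \<kappa>)\<^sup>2) \<le> w u"
            unfolding w_def using norm_triangle_ineq4[of "of_real (q u) :: complex" "(of_real \<kappa>)\<^sup>2"]
            by (simp add: norm_power)
          then have "cmod (of_real (q u) - (of_real \<kappa>)\<^sup>2) * cmod (f u) \<le> w u * B"
            using B(2)[of u] that \<open>x \<le> s\<close> \<open>t \<le> y\<close> xy w0[of u] by (intro mult_mono) auto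
          then show ?thesis by (simp add: norm_mult mult.commute)
        qed
      qed (use hi in blast)
      also have "\<dots> = B * integral {s..t} w" by simp
      also have "\<dots> \<le> B * I"
        unfolding I_def using B(1) that iwxy wi w0
        by (intro mult_left_mono integral_subset_le) auto
      finally show ?thesis .
    qed
    have f_inc: "cmod (f y - f t) \<le> B * (y - x)" if "t \<in> {x..y}" for t
    proof -
      have hi: "(g has_integral (f y - f t)) {t..y}"
        using that xy by (intro weak_solution_deriv_integral[OF sol]) auto
      have "cmod (f y - f t) \<le> B * (y - t)"
        using has_integral_bound[of B g "f y - f t" t y] hi B that xy by (auto simp: cbox_interval)
      also have "\<dots> \<le> B * (y - x)" using B(1) that by (intro mult_left_mono) auto
      finally show ?thesis .
    qed
    have part1: "\<bar>Im (cnj (f y) * (g y - g x))\<bar> \<le> B\<^sup>2 * (y - x) * I"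
    proof -
      have hi: "((\<lambda>t. (q t - \<kappa>\<^sup>2) * Im (cnj (f y) * f t)) has_integral Im (cnj (f y) * (g y - g x))) {x..y}"
      proof -
        have "((\<lambda>t. cnj (f y) * ((of_real (q t) - (of_real \<kappa>)\<^sup>2) * f t)) has_integral cnj (f y) * (g y - g x)) {x..y}"
          using xy by (intro has_integral_mult_right weak_solution_integral[OF sol])
        from has_integral_linear[OF this bounded_linear_Im]
        have "((\<lambda>t. Im (cnj (f y) * ((of_real (q t) - (of_real \<kappa>)\<^sup>2) * f t))) has_integral Im (cnj (f y) * (g y - g x))) {x..y}"
          by (simp add: o_def)
        moreover have "Im (cnj (f y) * ((of_real (q t) - (of_real \<kappa>)\<^sup>2) * f t)) = (q t - \<kappa>\<^sup>2) * Im (cnj (f y) * f t)" for t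
          by (simp add: algebra_simps flip: of_real_power)
        ultimately show ?thesis by simp
      qed
      have "\<bar>Im (cnj (f y) * (g y - g x))\<bar> \<le> integral {x..y} (\<lambda>t. B\<^sup>2 * (y - x) * w t)"
        unfolding integral_unique[OF hi, symmetric] real_norm_def[symmetric]
      proof (rule integral_norm_bound_integral)
        show "(\<lambda>t. B\<^sup>2 * (y - x) * w t) integrable_on {x..y}"
          using iwxy by (rule integrable_on_mult_right)
        show "norm ((q t - \<kappa>\<^sup>2) * Im (cnj (f y) * f t)) \<le> B\<^sup>2 * (y - x) * w t" if t: "t \<in> {x..y}" for t
        proof -
          have "Im (cnj (f y) * f t) = - Im (cnj (f y) * (f y - f t))"
            by (simp add: algebra_simps)
          then have "\<bar>Im (cnj (f y) * f t)\<bar> \<le> cmod (f y) * cmod (f y - f t)"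
            using abs_Im_le_cmod[of "cnj (f y) * (f y - f t)"] by (simp add: norm_mult)
          also have "\<dots> \<le> B * (B * (y - x))"
            using B f_inc[OF t] xy by (intro mult_mono) auto
          finally have "\<bar>Im (cnj (f y) * f t)\<bar> \<le> B\<^sup>2 * (y - x)" by (simp add: power2_eq_square)
          moreover have "\<bar>q t - \<kappa>\<^sup>2\<bar> \<le> w t"
            unfolding w_def using abs_triangle_ineq4[of "q t" "\<kappa>\<^sup>2"] by simp
          ultimately have "\<bar>q t - \<kappa>\<^sup>2\<bar> * \<bar>Im (cnj (f y) * f t)\<bar> \<le> w t * (B\<^sup>2 * (y - x))"
            using w0[of t] by (intro mult_mono) auto
          then show ?thesis by (simp add: abs_mult mult.commute)
        qed
      qed (use hi in blast)
      then show ?thesis by (simp add: I_def)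
    qed
    have part2: "\<bar>Im (cnj (f y - f x) * g x)\<bar> \<le> B\<^sup>2 * I * (y - x)"
    proof -
      have hi: "((\<lambda>t. Im (cnj (g t) * g x)) has_integral Im (cnj (f y - f x) * g x)) {x..y}"
      proof -
        have "bounded_linear (\<lambda>z. Im (cnj z * g x))"
          by (intro bounded_linear_compose[OF bounded_linear_Im]
                bounded_linear_compose[OF bounded_linear_mult_left] bounded_linear_cnj)
        from has_integral_linear[OF weak_solution_deriv_integral[OF sol xy] this]
        show ?thesis by (simp add: o_def)
      qed
      have "norm (Im (cnj (f y - f x) * g x)) \<le> B\<^sup>2 * I * measure lborel (cbox x y)"
      proof (rule has_integral_bound)
        show "((\<lambda>t. Im (cnj (g t) * g x)) has_integral Im (cnj (f y - f x) * g x)) (cbox x y)"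
          using hi by simp
        show "0 \<le> B\<^sup>2 * I"
          using has_integral_nonneg[OF wI] w0 by simp
        show "norm (Im (cnj (g t) * g x)) \<le> B\<^sup>2 * I" if "t \<in> cbox x y" for t
        proof -
          have "Im (cnj (g t) * g x) = Im (cnj (g t - g x) * g x)"
            by (simp add: algebra_simps)
          then have "\<bar>Im (cnj (g t) * g x)\<bar> \<le> cmod (g t - g x) * cmod (g x)"
            using abs_Im_le_cmod[of "cnj (g t - g x) * g x"] by (simp only: norm_mult complex_mod_cnj)
          also have "\<dots> \<le> (B * I) * B"
            using g_inc[of x t] that B xy by (intro mult_mono) (auto intro: order_trans[OF norm_ge_zero])
          finally show ?thesis by (simp add: power2_eq_square mult_ac)
        qed
      qed
      then show ?thesis using xy by simp
    qed
    have "cnj (f y) * g y - cnj (f x) * g x = cnj (f y) * (g y - g x) + cnj (f y - f x) * g x"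
      by (simp add: algebra_simps)
    then have "Im (cnj (f y) * g y) - Im (cnj (f x) * g x)
        = Im (cnj (f y) * (g y - g x)) + Im (cnj (f y - f x) * g x)"
      by (metis minus_complex.sel(2) plus_complex.sel(2))
    then show "\<bar>Im (cnj (f y) * g y) - Im (cnj (f x) * g x)\<bar> \<le> (y - x) * (W y - W x)"
      using part1 part2 unfolding W_diff by (simp add: algebra_simps)
  qed
qed

section \<open>The support of the potential\<close>

text \<open>
  Each point off the essential support has a neighbourhood on which \<open>q\<close> vanishes almost everywhere, and by
  Lindelof countably many of these neighbourhoods suffice.
\<close>

lemma AE_zero_outside_ess_support:
  "AE t in lebesgue. t \<in> D \<longrightarrow> t \<notin> ess_support D q \<longrightarrow> q t = 0"
proof -
  have "\<exists>e>0. AE t in lebesgue. t \<in> D \<and> \<bar>t - x\<bar> < e \<longrightarrow> q t = 0" if "x \<in> D - ess_support D q" for x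
    using that by (auto simp: ess_support_def)
  then obtain e where e: "\<And>x. x \<in> D - ess_support D q \<Longrightarrow> e x > 0"
      "\<And>x. x \<in> D - ess_support D q \<Longrightarrow> AE t in lebesgue. t \<in> D \<and> \<bar>t - x\<bar> < e x \<longrightarrow> q t = 0"
    by metis
  define U where "U x = ball x (e x)" for x
  obtain \<F> where \<F>: "\<F> \<subseteq> U ` (D - ess_support D q)" "countable \<F>" "\<Union>\<F> = \<Union>(U ` (D - ess_support D q))"
    using Lindelof[of "U ` (D - ess_support D q)"] by (auto simp: U_def)
  then obtain C where C: "countable C" "C \<subseteq> D - ess_support D q" "\<F> = U ` C"
    using countable_subset_image by metis
  have "AE t in lebesgue. \<forall>x\<in>C. t \<in> D \<and> \<bar>t - x\<bar> < e x \<longrightarrow> q t = 0"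
    using C e(2) by (subst AE_ball_countable) auto
  then show ?thesis
  proof eventually_elim
    case (elim t)
    show ?case
    proof (intro impI)
      assume t: "t \<in> D" "t \<notin> ess_support D q"
      then have "t \<in> U t" using e(1) by (auto simp: U_def)
      then have "t \<in> \<Union>\<F>" using t \<F>(3) by blast
      then obtain x where "x \<in> C" "t \<in> U x" using C(3) by blast
      then show "q t = 0"
        using elim t by (auto simp: U_def dist_real_def abs_minus_commute)
    qed
  qed
qed

lemma negligible_potential_off_ess_support:
  assumes "{a..b} \<subseteq> D" "ess_support D q \<inter> {a..b} \<subseteq> {c}"
  shows "negligible {t \<in> {a..b}. q t \<noteq> 0}"
proof -
  obtain N where N: "N \<in> null_sets lebesgue"
      "{t. \<not> (t \<in> D \<longrightarrow> t \<notin> ess_support D q \<longrightarrow> q t = 0)} \<subseteq> N"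
    using AE_zero_outside_ess_support[of D q] by (auto simp: eventually_ae_filter)
  have "negligible (N \<union> {c})"
    using N(1) by (auto simp: negligible_iff_null_sets[symmetric])
  then show ?thesis
    by (rule negligible_subset) (use N(2) assms in blast)
qed

lemma ess_support_within_Sup:
  assumes "compact (ess_support {0..} q)" and ne: "ess_support {0..} q \<noteq> {}"
  shows "0 \<le> Sup (ess_support {0..} q)" "ess_support {0..} q \<subseteq> {0..Sup (ess_support {0..} q)}"
proof -
  have nonneg: "0 \<le> x" if "x \<in> ess_support {0..} q" for x
    using that by (simp add: ess_support_def)
  have "bdd_above (ess_support {0..} q)"
    using assms(1) by (simp add: bounded_imp_bdd_above compact_imp_bounded)
  then have le: "x \<le> Sup (ess_support {0..} q)" if "x \<in> ess_support {0..} q" for x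
    using that by (simp add: cSup_upper)
  obtain x where "x \<in> ess_support {0..} q" using ne by blast
  then show "0 \<le> Sup (ess_support {0..} q)" using nonneg le by (meson order_trans)
  show "ess_support {0..} q \<subseteq> {0..Sup (ess_support {0..} q)}"
    using nonneg le by (meson atLeastAtMost_iff subsetI)
qed

lemma support_bound_imp:
  assumes "support_bound c q \<gamma>" and "compact (ess_support (domain c) q)"
  shows "0 \<le> \<gamma>" "ess_support (domain c) q \<subseteq> {0..\<gamma>}"
proof -
  have "0 \<le> \<gamma> \<and> ess_support (domain c) q \<subseteq> {0..\<gamma>}"
  proof (cases "c = Line")
    case False
    then have "domain c = {0..}" "\<gamma> = (if ess_support {0..} q = {} then 0 else Sup (ess_support {0..} q))"
      using assms(1) by (cases c; simp)+
    then show ?thesis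
      using ess_support_within_Sup[of q] assms(2) by (cases "ess_support {0..} q = {}") auto
  qed (use assms(1) in simp)
  then show "0 \<le> \<gamma>" "ess_support (domain c) q \<subseteq> {0..\<gamma>}" by auto
qed

section \<open>Jost solutions and the Jost function\<close>

lemma schroedinger_solution_weak:
  assumes sol: "schroedinger_solution D q k f" and ab: "{a..b} \<subseteq> D"
  shows "weak_solution q k a b f (deriv_on D f)"
  unfolding weak_solution_def
proof (intro conjI ballI allI impI)
  show "(f has_vector_derivative deriv_on D f x) (at x within {a..b})" if "x \<in> {a..b}" for x
  proof -
    have "f differentiable (at x within D)"
      using sol ab that by (auto simp: schroedinger_solution_def)
    then have "(f has_vector_derivative deriv_on D f x) (at x within D)"
      by (simp add: deriv_on_def vector_derivative_works)
    then show ?thesis using ab by (rule has_vector_derivative_within_subset)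
  qed
  show "((\<lambda>t. (of_real (q t) - k\<^sup>2) * f t) has_integral (deriv_on D f y - deriv_on D f x)) {x..y}"
    if "a \<le> x" "x \<le> y" "y \<le> b" for x y
  proof -
    have "x \<in> D" "y \<in> D" using ab that by auto
    then have "set_integrable lebesgue {x..y} (\<lambda>t. (of_real (q t) - k\<^sup>2) * f t)"
        "deriv_on D f y - deriv_on D f x = (LINT t:{x..y}|lebesgue. (of_real (q t) - k\<^sup>2) * f t)"
      using sol that(2) unfolding schroedinger_solution_def by blast+
    then show ?thesis
      using set_lebesgue_integral_eq_integral by (metis has_integral_integral)
  qed
qed

lemma deriv_on_exp:
  fixes \<sigma> :: complex
  assumes diff: "f differentiable (at x within D)" and U: "open U" "x \<in> U" "U \<subseteq> D"
    and eq: "\<And>t. t \<in> U \<Longrightarrow> f t = exp (\<sigma> * of_real t)"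
  shows "deriv_on D f x = \<sigma> * exp (\<sigma> * of_real x)"
proof -
  have at: "at x within D = at x"
    using U by (meson at_within_interior interior_maximal subsetD)
  have "(f has_vector_derivative deriv_on D f x) (at x)"
    using diff by (simp add: deriv_on_def vector_derivative_works at)
  moreover have "((\<lambda>t. exp (\<sigma> * of_real t)) has_vector_derivative \<sigma> * exp (\<sigma> * of_real x)) (at x)"
    by (rule has_vector_derivative_real_field) (auto intro!: derivative_eq_intros)
  then have "(f has_vector_derivative \<sigma> * exp (\<sigma> * of_real x)) (at x)"
    by (rule has_vector_derivative_transform_within_open[OF _ U(1,2)]) (simp add: eq)
  ultimately show ?thesis by (rule vector_derivative_unique_at)
qed

text \<open>
  A Jost solution is prescribed only for large \<open>x\<close>; uniqueness for the free equation carries the exponential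
  back to the end of the support.
\<close>

lemma jost_plus_right_of_support:
  assumes jost: "jost_plus D q k f" and D: "{0..} \<subseteq> D" and k: "k \<noteq> 0"
    and \<gamma>: "0 \<le> \<gamma>" "ess_support D q \<subseteq> {..\<gamma>}"
  shows "f \<gamma> = exp (\<i> * k * of_real \<gamma>)" "deriv_on D f \<gamma> = \<i> * k * exp (\<i> * k * of_real \<gamma>)"
proof -
  have sol: "schroedinger_solution D q k f" using jost by (simp add: jost_plus_def)
  obtain X where X: "\<And>x. x \<ge> X \<Longrightarrow> f x = exp (\<i> * k * of_real x)"
    using jost by (auto simp: jost_plus_def eventually_at_top_linorder)
  define b where "b = max \<gamma> X + 1"
  have "b \<in> D" using D \<gamma> by (auto simp: b_def)
  then have "f differentiable (at b within D)" using sol by (simp add: schroedinger_solution_def)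
  then have "deriv_on D f b = \<i> * k * exp (\<i> * k * of_real b)"
    by (rule deriv_on_exp[of _ _ _ "{max \<gamma> X<..}"]) (use D \<gamma> X in \<open>auto simp: b_def\<close>)
  moreover have "f b = exp (\<i> * k * of_real b)" by (rule X) (simp add: b_def)
  moreover have sub: "{\<gamma>..b} \<subseteq> D" using D \<gamma> by auto
  then have "negligible {t \<in> {\<gamma>..b}. q t \<noteq> 0}"
    by (rule negligible_potential_off_ess_support[where c = \<gamma>]) (use \<gamma> in auto)
  moreover have "(\<i> * k)\<^sup>2 = - k\<^sup>2" by (simp add: power_mult_distrib)
  moreover have "\<gamma> \<le> b" by (simp add: b_def)
  ultimately show "f \<gamma> = exp (\<i> * k * of_real \<gamma>)" "deriv_on D f \<gamma> = \<i> * k * exp (\<i> * k * of_real \<gamma>)"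
    using k free_solution_unique[OF schroedinger_solution_weak[OF sol sub],
        where c = b and d = \<gamma> and \<sigma> = "\<i> * k"] by simp_all
qed

lemma jost_minus_left_of_support:
  assumes jost: "jost_minus UNIV q k f" and k: "k \<noteq> 0" and supp: "ess_support UNIV q \<subseteq> {0..}"
  shows "f 0 = 1" "deriv_on UNIV f 0 = - (\<i> * k)"
proof -
  have sol: "schroedinger_solution UNIV q k f" using jost by (simp add: jost_minus_def)
  obtain X where X: "\<And>x. x \<le> X \<Longrightarrow> f x = exp (- (\<i> * k) * of_real x)"
    using jost by (auto simp: jost_minus_def eventually_at_bot_linorder)
  define a where "a = min 0 X - 1"
  have "f differentiable (at a within UNIV)" using sol by (simp add: schroedinger_solution_def)
  then have "deriv_on UNIV f a = - (\<i> * k) * exp (- (\<i> * k) * of_real a)"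
    by (rule deriv_on_exp[of _ _ _ "{..<min 0 X}"]) (use X in \<open>auto simp: a_def\<close>)
  moreover have "f a = exp (- (\<i> * k) * of_real a)" by (rule X) (simp add: a_def)
  moreover have "negligible {t \<in> {a..0}. q t \<noteq> 0}"
    by (rule negligible_potential_off_ess_support[where c = 0 and D = UNIV]) (use supp in auto)
  moreover have "(- (\<i> * k))\<^sup>2 = - k\<^sup>2" by (simp add: power_mult_distrib)
  moreover have "a \<le> 0" by (simp add: a_def)
  ultimately show "f 0 = 1" "deriv_on UNIV f 0 = - (\<i> * k)"
    using k free_solution_unique[OF schroedinger_solution_weak[OF sol subset_UNIV],
        where a = a and b = 0 and c = a and d = 0 and \<sigma> = "- (\<i> * k)"] by simp_all
qed

lemma norm_q_ge_integral:
  assumes "set_integrable lebesgue D q" "{a..b} \<subseteq> D"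
  shows "(\<lambda>t. \<bar>q t\<bar>) integrable_on {a..b}" "integral {a..b} (\<lambda>t. \<bar>q t\<bar>) \<le> norm_q D q"
proof -
  have abs: "set_integrable lebesgue D (\<lambda>t. \<bar>q t\<bar>)"
    using assms(1) by (rule set_integrable_abs)
  then have "set_integrable lebesgue {a..b} (\<lambda>t. \<bar>q t\<bar>)"
    by (rule set_integrable_subset) (use assms in auto)
  then show int: "(\<lambda>t. \<bar>q t\<bar>) integrable_on {a..b}"
    by (rule set_lebesgue_integral_eq_integral)
  have "norm_q D q = integral D (\<lambda>t. \<bar>q t\<bar>)" "(\<lambda>t. \<bar>q t\<bar>) integrable_on D"
    unfolding norm_q_def using set_lebesgue_integral_eq_integral[OF abs] by auto
  then show "integral {a..b} (\<lambda>t. \<bar>q t\<bar>) \<le> norm_q D q"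
    using int assms(2) by (simp add: integral_subset_le)
qed

text \<open>
  The energy of $e^{ikx}$ at \<open>\<gamma>\<close> is $2|k|e^{-\gamma\,\mathrm{Im}\,k}$, and Gronwall's inequality transports it
  to \<open>0\<close>.
\<close>

lemma jost_plus_energy_bound:
  assumes q: "set_integrable lebesgue D q" and jost: "jost_plus D q k f" and D: "{0..} \<subseteq> D" and k: "k \<noteq> 0"
    and \<gamma>: "0 \<le> \<gamma>" "ess_support D q \<subseteq> {..\<gamma>}"
  shows "cmod k * cmod (f 0) + cmod (deriv_on D f 0)
    \<le> 2 * cmod k * exp (- Im k * \<gamma> + cmod k * \<gamma> + norm_q D q / cmod k)"
proof -
  have D\<gamma>: "{0..\<gamma>} \<subseteq> D" using D by auto
  have "weak_solution q k 0 \<gamma> f (deriv_on D f)"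
    using jost D\<gamma> by (auto simp: jost_plus_def intro: schroedinger_solution_weak)
  from weak_solution_energy_growth(1)[OF this k \<gamma>(1) norm_q_ge_integral(1)[OF q D\<gamma>]]
  have "cmod k * cmod (f 0) + cmod (deriv_on D f 0)
      \<le> (cmod k * cmod (f \<gamma>) + cmod (deriv_on D f \<gamma>))
         * exp (cmod k * \<gamma> + integral {0..\<gamma>} (\<lambda>t. \<bar>q t\<bar>) / cmod k)" by simp
  also have "\<dots> \<le> (cmod k * cmod (f \<gamma>) + cmod (deriv_on D f \<gamma>))
         * exp (cmod k * \<gamma> + norm_q D q / cmod k)"
    using norm_q_ge_integral(2)[OF q D\<gamma>] by (intro mult_left_mono) (auto intro!: divide_right_mono)
  also have "cmod k * cmod (f \<gamma>) + cmod (deriv_on D f \<gamma>) = 2 * cmod k * exp (- Im k * \<gamma>)"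
    using jost_plus_right_of_support[OF jost D k \<gamma>] by (simp add: norm_mult norm_exp_eq_Re)
  finally show ?thesis by (simp only: exp_add mult.assoc)
qed

lemma jost_plus_flux:
  assumes q: "set_integrable lebesgue D q" and jost: "jost_plus D q 1 f" and D: "{0..} \<subseteq> D"
    and \<gamma>: "0 \<le> \<gamma>" "ess_support D q \<subseteq> {..\<gamma>}"
  shows "Im (cnj (f 0) * deriv_on D f 0) = 1"
proof -
  have D\<gamma>: "{0..\<gamma>} \<subseteq> D" using D by auto
  have "weak_solution q (of_real 1) 0 \<gamma> f (deriv_on D f)"
    using jost D\<gamma> by (auto simp: jost_plus_def intro: schroedinger_solution_weak)
  from flux_constant[OF this \<gamma>(1) norm_q_ge_integral(1)[OF q D\<gamma>]]
  have "Im (cnj (f 0) * deriv_on D f 0) = Im (cnj (f \<gamma>) * deriv_on D f \<gamma>)" .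
  also have "cnj (f \<gamma>) * deriv_on D f \<gamma> = \<i> * (f \<gamma> * cnj (f \<gamma>))"
    using jost_plus_right_of_support[OF jost D _ \<gamma>] by simp
  also have "f \<gamma> * cnj (f \<gamma>) = 1"
    unfolding complex_norm_square[symmetric]
    using jost_plus_right_of_support[OF jost D _ \<gamma>] by (simp add: norm_exp_eq_Re)
  finally show ?thesis by simp
qed

text \<open>
  On the line $\psi_-$ has at \<open>0\<close> the Cauchy data of $e^{-ikx}$, because the support lies to the right of \<open>0\<close>.
  So in all three cases the Jost function is a combination of the Cauchy data of $\psi_+$ at \<open>0\<close>.
\<close>

lemma jost_value_cases:
  assumes val: "jost_value c q k v" and k: "k \<noteq> 0" and supp: "ess_support (domain c) q \<subseteq> {0..}"
  obtains f where "jost_plus (domain c) q k f"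
    "v = (case c of Line \<Rightarrow> deriv_on (domain c) f 0 + \<i> * k * f 0
            | Dirichlet \<Rightarrow> f 0 | Neumann \<Rightarrow> deriv_on (domain c) f 0)"
proof (cases c)
  case Line
  then obtain \<psi>m \<psi>p where \<psi>: "jost_minus UNIV q k \<psi>m" "jost_plus UNIV q k \<psi>p" "v = wronskian UNIV \<psi>m \<psi>p 0"
    using val by auto
  then have "v = deriv_on UNIV \<psi>p 0 + \<i> * k * \<psi>p 0"
    using jost_minus_left_of_support[OF \<psi>(1) k] supp Line by (simp add: wronskian_def)
  then show ?thesis using that[of \<psi>p] \<psi>(2) Line by simp
qed (use val that in auto)

text \<open>
  In each case the combination of Cauchy data is at most the energy at \<open>0\<close>, since $|k| \ge 1$.
\<close>

lemma jost_value_upper_bound: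
  assumes q: "set_integrable lebesgue (domain c) q" and val: "jost_value c q k v" and k: "1 \<le> cmod k"
    and \<gamma>: "0 \<le> \<gamma>" "ess_support (domain c) q \<subseteq> {0..\<gamma>}"
  shows "cmod v \<le> 2 * cmod k * exp (2 * cmod k * \<gamma> + norm_q (domain c) q)"
proof -
  have "k \<noteq> 0" using k by auto
  obtain f where f: "jost_plus (domain c) q k f"
      and v: "v = (case c of Line \<Rightarrow> deriv_on (domain c) f 0 + \<i> * k * f 0
            | Dirichlet \<Rightarrow> f 0 | Neumann \<Rightarrow> deriv_on (domain c) f 0)"
    by (rule jost_value_cases[OF val \<open>k \<noteq> 0\<close>]) (use \<gamma> in auto)
  have D: "{0..} \<subseteq> domain c" by (cases c) auto
  have "cmod (f 0) \<le> cmod k * cmod (f 0)"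
    using k mult_right_mono[of 1 "cmod k" "cmod (f 0)"] by simp
  then have "cmod v \<le> cmod k * cmod (f 0) + cmod (deriv_on (domain c) f 0)"
    unfolding v using norm_triangle_ineq[of "deriv_on (domain c) f 0" "\<i> * k * f 0"]
    by (cases c) (auto simp: norm_mult intro: add_increasing2)
  also have "\<dots> \<le> 2 * cmod k * exp (- Im k * \<gamma> + cmod k * \<gamma> + norm_q (domain c) q / cmod k)"
    using \<gamma> by (intro jost_plus_energy_bound[OF q f D \<open>k \<noteq> 0\<close>]) auto
  also have "\<dots> \<le> 2 * cmod k * exp (2 * cmod k * \<gamma> + norm_q (domain c) q)"
  proof -
    have "- Im k * \<gamma> \<le> cmod k * \<gamma>"
      using abs_Im_le_cmod[of k] \<gamma> by (intro mult_right_mono) auto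
    moreover have "0 \<le> norm_q (domain c) q"
      by (simp add: norm_q_def set_lebesgue_integral_def integral_nonneg)
    then have "norm_q (domain c) q / cmod k \<le> norm_q (domain c) q"
      using k by (simp add: divide_le_eq mult_le_cancel_left1)
    ultimately have "- Im k * \<gamma> + cmod k * \<gamma> + norm_q (domain c) q / cmod k
        \<le> 2 * cmod k * \<gamma> + norm_q (domain c) q"
      by linarith
    then show ?thesis by (intro mult_left_mono) auto
  qed
  finally show ?thesis .
qed

text \<open>
  At \<open>k = 1\<close> the flux of $\psi_+$ is \<open>1\<close>. On the half-line this gives $|\psi_+(0)||\psi_+'(0)| \ge 1$, so neither
  factor can be small because the other one is bounded by the energy. On the line
  $|\psi_+' + i\psi_+|^2 = |\psi_+'|^2 + |\psi_+|^2 + 2\,\mathrm{flux}$.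
\<close>

lemma jost_value_lower_bound:
  assumes q: "set_integrable lebesgue (domain c) q" and val: "jost_value c q 1 v"
    and \<gamma>: "0 \<le> \<gamma>" "ess_support (domain c) q \<subseteq> {0..\<gamma>}"
  shows "exp (- \<gamma> - norm_q (domain c) q) / 2 \<le> cmod v"
proof -
  obtain f where f: "jost_plus (domain c) q 1 f"
      and v: "v = (case c of Line \<Rightarrow> deriv_on (domain c) f 0 + \<i> * 1 * f 0
            | Dirichlet \<Rightarrow> f 0 | Neumann \<Rightarrow> deriv_on (domain c) f 0)"
    by (rule jost_value_cases[OF val]) (use \<gamma> in auto)
  have D: "{0..} \<subseteq> domain c" by (cases c) auto
  define g where "g = deriv_on (domain c) f 0"
  have \<gamma>': "ess_support (domain c) q \<subseteq> {..\<gamma>}" using \<gamma> by auto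
  have flux: "Im (cnj (f 0) * g) = 1"
    unfolding g_def using jost_plus_flux[OF q f D \<gamma>(1) \<gamma>'] .
  have energy: "cmod (f 0) + cmod g \<le> 2 * exp (\<gamma> + norm_q (domain c) q)"
    unfolding g_def using jost_plus_energy_bound[OF q f D _ \<gamma>(1) \<gamma>'] by simp
  have "1 \<le> cmod (f 0) * cmod g"
    using abs_Im_le_cmod[of "cnj (f 0) * g"] flux by (simp add: norm_mult)
  have half: "exp (- \<gamma> - norm_q (domain c) q) / 2 \<le> x" if "1 \<le> x * y" "0 \<le> x" "y \<le> 2 * exp (\<gamma> + norm_q (domain c) q)" for x y
  proof -
    have "1 \<le> x * (2 * exp (\<gamma> + norm_q (domain c) q))"
      using that mult_left_mono[OF that(3,2)] by linarith
    then have "1 / (2 * exp (\<gamma> + norm_q (domain c) q)) \<le> x"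
      by (subst pos_divide_le_eq) auto
    moreover have "exp (- \<gamma> - norm_q (domain c) q) = exp (- (\<gamma> + norm_q (domain c) q))"
      by simp
    ultimately show ?thesis by (simp only: exp_minus) (simp add: field_simps)
  qed
  show ?thesis
  proof (cases c)
    case Line
    have "1 \<le> (cmod (g + \<i> * f 0))\<^sup>2"
    proof -
      have "(cmod (g + \<i> * f 0))\<^sup>2 = (cmod g)\<^sup>2 + (cmod (f 0))\<^sup>2 + 2 * Im (cnj (f 0) * g)"
        unfolding cmod_power2 by (simp add: power2_eq_square algebra_simps)
      then show ?thesis unfolding flux by simp
    qed
    then have "1 \<le> cmod (g + \<i> * f 0)"
      using power2_le_imp_le[of 1 "cmod (g + \<i> * f 0)"] by simp
    then have "1 \<le> cmod v" using v Line by (simp add: g_def)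
    moreover have "0 \<le> norm_q (domain c) q"
      by (simp add: norm_q_def set_lebesgue_integral_def integral_nonneg)
    then have "exp (- \<gamma> - norm_q (domain c) q) \<le> 1" using \<gamma>(1) by simp
    ultimately show ?thesis by linarith
  next
    case Dirichlet
    then show ?thesis
      using half[OF \<open>1 \<le> cmod (f 0) * cmod g\<close> norm_ge_zero] energy v norm_ge_zero[of "f 0"]
      by (simp del: norm_ge_zero)
  next
    case Neumann
    have "1 \<le> cmod g * cmod (f 0)" "cmod (f 0) \<le> 2 * exp (\<gamma> + norm_q (domain c) q)"
      using \<open>1 \<le> cmod (f 0) * cmod g\<close> energy norm_ge_zero[of g] by (simp add: mult.commute, linarith)
    from half[OF this(1) norm_ge_zero this(2)] show ?thesis
      using v Neumann by (simp add: g_def)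
  qed
qed

section \<open>Counting and summing the zeros of the Jost function\<close>

text \<open>
  The zeros of modulus at most $s$ lie in the disc of radius $s + 1 \le \frac32 s$ around \<open>1\<close>. They are
  compared with the circle of radius \<open>6 * s\<close>, which stays in the region $|k| \ge 1$; the ratio of the two
  radii makes each zero count for a factor $(6 - \frac32)/\frac32 = 3 \ge e$. The coefficient of \<open>\<gamma>\<close> matters
  later: it has to be at most $\frac43 \cdot 32/\pi \approx 13.58$.
\<close>

lemma zorder_count_le:
  fixes F :: "complex \<Rightarrow> complex"
  assumes holo: "F holomorphic_on UNIV" and \<gamma>: "0 \<le> \<gamma>" and Q: "0 \<le> Q"
    and upper: "\<And>k. 1 \<le> cmod k \<Longrightarrow> cmod (F k) \<le> 2 * cmod k * exp (2 * cmod k * \<gamma> + Q)"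
    and lower: "exp (- \<gamma> - Q) / 2 \<le> cmod (F 1)"
    and T: "finite T" "T \<subseteq> cball 0 s" and s: "2 \<le> s"
  shows "real (\<Sum>k\<in>T. nat (zorder F k)) \<le> (26 + 27 / 2 * \<gamma> + Q) * s"
proof -
  define n where "n = (\<Sum>k\<in>T. nat (zorder F k))"
  \<comment> \<open>\<open>\<rho>\<close> bounds \<open>cmod k\<close> on the circle of radius \<open>6 * s\<close> around \<open>1\<close>.\<close>
  define \<rho> where "\<rho> = 6 * s + 1"
  have "T \<subseteq> cball 1 (3 / 2 * s)"
  proof
    fix k assume "k \<in> T"
    then have "dist 0 k \<le> s" using T by auto
    then show "k \<in> cball 1 (3 / 2 * s)"
      using dist_triangle[of 1 k 0] s by simp
  qed
  moreover have "cmod (F z) \<le> 2 * \<rho> * exp (2 * \<rho> * \<gamma> + Q)" if z: "dist 1 z = 6 * s" for z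
  proof -
    have "cmod z \<le> \<rho>" "1 \<le> cmod z"
      using z s norm_triangle_ineq2[of z 1] norm_triangle_ineq4[of 1 z]
      by (simp_all add: \<rho>_def dist_norm norm_minus_commute)
    moreover from this have "2 * cmod z * \<gamma> \<le> 2 * \<rho> * \<gamma>"
      using \<gamma> by (intro mult_right_mono) auto
    ultimately have "2 * cmod z * exp (2 * cmod z * \<gamma> + Q) \<le> 2 * \<rho> * exp (2 * \<rho> * \<gamma> + Q)"
      by (intro mult_mono) auto
    then show ?thesis using upper[OF \<open>1 \<le> cmod z\<close>] by linarith
  qed
  moreover have "0 < cmod (F 1)"
    using lower exp_gt_zero[of "- \<gamma> - Q"] by linarith
  then have "F 1 \<noteq> 0" by simp
  ultimately have "((6 * s - 3 / 2 * s) / (3 / 2 * s)) ^ n * cmod (F 1) \<le> 2 * \<rho> * exp (2 * \<rho> * \<gamma> + Q)"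
    unfolding n_def using s T(1) by (intro zero_count_bound[OF holo]) auto
  moreover have "(6 * s - 3 / 2 * s) / (3 / 2 * s) = 3"
    using s by (simp add: field_simps)
  ultimately have "3 ^ n * cmod (F 1) \<le> 2 * \<rho> * exp (2 * \<rho> * \<gamma> + Q)"
    by simp
  moreover have "3 ^ n * (exp (- \<gamma> - Q) / 2) \<le> 3 ^ n * cmod (F 1)"
    using lower by (intro mult_left_mono) auto
  ultimately have le: "3 ^ n * (exp (- \<gamma> - Q) / 2) \<le> 2 * \<rho> * exp (2 * \<rho> * \<gamma> + Q)"
    by linarith
  have "3 ^ n = 3 ^ n * (exp (- \<gamma> - Q) / 2) * (2 * exp (\<gamma> + Q))"
    using exp_add[of "- \<gamma> - Q" "\<gamma> + Q"] by simp
  also have "\<dots> \<le> 2 * \<rho> * exp (2 * \<rho> * \<gamma> + Q) * (2 * exp (\<gamma> + Q))"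
    using le by (intro mult_right_mono) auto
  also have "\<dots> = 4 * \<rho> * exp (2 * \<rho> * \<gamma> + Q + (\<gamma> + Q))"
    by (simp only: exp_add)
  finally have three: "3 ^ n \<le> 4 * \<rho> * exp ((2 * \<rho> + 1) * \<gamma> + 2 * Q)"
    by (simp add: algebra_simps)
  have "exp (real n) = exp 1 ^ n" by (simp flip: exp_of_nat_mult)
  also have "\<dots> \<le> 3 ^ n" using exp_le by (intro power_mono) auto
  also note three
  also have "4 * \<rho> * exp ((2 * \<rho> + 1) * \<gamma> + 2 * Q) \<le> exp (4 * \<rho>) * exp ((2 * \<rho> + 1) * \<gamma> + 2 * Q)"
  proof (rule mult_right_mono)
    show "4 * \<rho> \<le> exp (4 * \<rho>)" using exp_ge_add_one_self[of "4 * \<rho>"] by linarith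
  qed simp
  also have "\<dots> = exp (4 * \<rho> + ((2 * \<rho> + 1) * \<gamma> + 2 * Q))"
    by (simp only: exp_add)
  finally have "real n \<le> 4 * \<rho> + ((2 * \<rho> + 1) * \<gamma> + 2 * Q)" by simp
  also have "\<dots> \<le> 26 * s + (27 / 2 * s * \<gamma> + s * Q)"
    using s \<gamma> Q by (intro add_mono mult_right_mono) (auto simp: \<rho>_def)
  finally show ?thesis by (simp add: n_def algebra_simps)
qed

text \<open>
  The zeros in \<open>Z\<close> at distance at most \<open>s\<close> from \<open>a\<close> have modulus at most \<open>s\<close>, so their number is at most
  \<open>A * s\<close>, and the layer cake formula starts at \<open>s = 2\<close>.
\<close>

lemma zero_sum_bound:
  fixes F :: "complex \<Rightarrow> complex"
  assumes holo: "F holomorphic_on UNIV" and \<gamma>: "0 \<le> \<gamma>" and Q: "0 \<le> Q"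
    and upper: "\<And>k. 1 \<le> cmod k \<Longrightarrow> cmod (F k) \<le> 2 * cmod k * exp (2 * cmod k * \<gamma> + Q)"
    and lower: "exp (- \<gamma> - Q) / 2 \<le> cmod (F 1)"
    and Z: "\<And>k. k \<in> Z \<Longrightarrow> cmod k \<le> cmod (k - a)" "\<And>k. k \<in> Z \<Longrightarrow> 2 \<le> cmod (k - a)"
    and p: "1 < p"
  shows "zero_sum_term F a p summable_on Z"
    and "(\<Sum>\<^sub>\<infinity>k\<in>Z. zero_sum_term F a p k) \<le> 32 * Y_const p * (1 + \<gamma> / pi + Q)"
proof -
  define A where "A = 26 + 27 / 2 * \<gamma> + Q"
  have "0 < cmod (F 1)"
    using lower exp_gt_zero[of "- \<gamma> - Q"] by linarith
  then have "\<exists>w\<in>UNIV. F w \<noteq> 0" by auto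
  then have ord: "0 \<le> zorder F k" for k
    using zorder_exist_zero[OF holo open_UNIV connected_UNIV UNIV_I, of k] by (auto split: if_splits)
  have summand: "zero_sum_term F a p k = real (nat (zorder F k)) * cmod (k - a) powr - p" for k
    using ord[of k] by (simp add: zero_sum_term_def powr_minus_divide)
  have constants: "A * (p / (p - 1)) * 2 powr (1 - p) \<le> 32 * Y_const p * (1 + \<gamma> / pi + Q)"
  proof -
    have "A * (p / (p - 1)) * 2 powr (1 - p) = A * (p * 2 powr (1 - p)) / (p - 1)"
      by simp
    also have "\<dots> \<le> A * (3 / 2) / (p - 1)"
      using power_factor_le[OF p] p \<gamma> Q by (intro divide_right_mono mult_left_mono) (auto simp: A_def)
    also have "\<dots> = 3 / 4 * A * (2 / (p - 1))" by simp
    also have "\<dots> \<le> 3 / 4 * A * Y_const p"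
      using Y_const_ge[OF p] \<gamma> Q by (intro mult_left_mono) (auto simp: A_def)
    also have "\<dots> \<le> 32 * (1 + \<gamma> / pi + Q) * Y_const p"
    proof (rule mult_right_mono)
      \<comment> \<open>The tightest of the three coefficients: $\frac34 \cdot \frac{27}2 = \frac{81}8$ against $32/\pi \approx 10.19$.\<close>
      have "81 / 8 \<le> 32 / pi" using pi_approx(2) by (simp add: pos_le_divide_eq)
      then have "81 / 8 * \<gamma> \<le> 32 / pi * \<gamma>" using \<gamma> by (rule mult_right_mono)
      then have "81 / 8 * \<gamma> \<le> 32 * (\<gamma> / pi)" by simp
      then show "3 / 4 * A \<le> 32 * (1 + \<gamma> / pi + Q)"
        using Q unfolding A_def distrib_left by linarith
      have "0 \<le> 2 / (p - 1)" using p by simp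
      then show "0 \<le> Y_const p" using Y_const_ge[OF p] by linarith
    qed
    finally show ?thesis by (simp only: mult_ac)
  qed
  have finite_bound: "sum (zero_sum_term F a p) S \<le> 32 * Y_const p * (1 + \<gamma> / pi + Q)"
    if S: "finite S" "S \<subseteq> Z" for S
  proof -
    have "sum (zero_sum_term F a p) S = (\<Sum>k\<in>S. real (nat (zorder F k)) * cmod (k - a) powr - p)"
      by (simp add: summand)
    also have "\<dots> \<le> A * (p / (p - 1)) * 2 powr (1 - p)"
    proof (rule sum_powr_le_of_linear_count[where d = "\<lambda>k. cmod (k - a)" and r = 2])
      show "(\<Sum>k | k \<in> S \<and> cmod (k - a) \<le> s. real (nat (zorder F k))) \<le> A * s" if "2 \<le> s" for s
      proof -
        have "cmod k \<le> s" if "k \<in> S" "cmod (k - a) \<le> s" for k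
          using Z(1)[of k] S(2) that by auto
        then have "{k \<in> S. cmod (k - a) \<le> s} \<subseteq> cball 0 s"
          by auto
        then have "real (\<Sum>k | k \<in> S \<and> cmod (k - a) \<le> s. nat (zorder F k)) \<le> A * s"
          unfolding A_def using S(1) that
          by (intro zorder_count_le[OF holo \<gamma> Q upper lower]) auto
        then show ?thesis by simp
      qed
    qed (use S Z(2) p in auto)
    finally show ?thesis using constants by linarith
  qed
  show summable: "zero_sum_term F a p summable_on Z"
  proof (rule nonneg_bdd_above_summable_on)
    show "bdd_above (sum (zero_sum_term F a p) ` {S. S \<subseteq> Z \<and> finite S})"
      using finite_bound by (intro bdd_aboveI2) auto
  qed (simp add: summand)
  show "(\<Sum>\<^sub>\<infinity>k\<in>Z. zero_sum_term F a p k) \<le> 32 * Y_const p * (1 + \<gamma> / pi + Q)"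
    using summable finite_bound by (intro infsum_le_finite_sums) auto
qed

theorem theorem1p2:
  shows "\<exists>C::real. C \<le> 2 ^ 5 \<and>
    (\<forall>(c::schroedinger_case) (q::real \<Rightarrow> real) (\<gamma>::real) (F::complex \<Rightarrow> complex) (p::real).
       set_integrable lebesgue (domain c) q \<and>
       compact (ess_support (domain c) q) \<and>
       support_bound c q \<gamma> \<and>
       jost_function c q F \<and>
       p > 1 \<longrightarrow>
       zero_sum_term F (2 * \<i>) p summable_on {k. F k = 0 \<and> Im k \<le> 0} \<and>
       (\<Sum>\<^sub>\<infinity>k\<in>{k. F k = 0 \<and> Im k \<le> 0}. zero_sum_term F (2 * \<i>) p k)
         \<le> C * Y_const p * (1 + \<gamma> / pi + Q_const c q \<gamma>) \<and>
       zero_sum_term F (- 2 * \<i>) p summable_on {k. F k = 0 \<and> Im k \<ge> 0} \<and>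
       (\<Sum>\<^sub>\<infinity>k\<in>{k. F k = 0 \<and> Im k \<ge> 0}. zero_sum_term F (- 2 * \<i>) p k)
         \<le> C * Y_const p * (1 + \<gamma> / pi + Q_const c q \<gamma>))"
proof (intro exI[of _ 32] conjI allI impI)
  fix c :: schroedinger_case and q :: "real \<Rightarrow> real" and \<gamma> p :: real and F :: "complex \<Rightarrow> complex"
  assume "set_integrable lebesgue (domain c) q \<and>
       compact (ess_support (domain c) q) \<and>
       support_bound c q \<gamma> \<and>
       jost_function c q F \<and>
       p > 1"
  then have q: "set_integrable lebesgue (domain c) q" and "compact (ess_support (domain c) q)"
    and "support_bound c q \<gamma>" and F: "jost_function c q F" and p: "p > 1"
    by auto
  then have \<gamma>: "0 \<le> \<gamma>" "ess_support (domain c) q \<subseteq> {0..\<gamma>}"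
    using support_bound_imp by auto
  have holo: "F holomorphic_on UNIV" and val: "\<And>k. k \<noteq> 0 \<Longrightarrow> jost_value c q k (F k)"
    using F by (auto simp: jost_function_def)
  have nonneg: "0 \<le> norm_q (domain c) q"
    by (simp add: norm_q_def set_lebesgue_integral_def integral_nonneg)
  have Q: "norm_q (domain c) q \<le> Q_const c q \<gamma>"
  proof (cases "c = Line")
    case False
    then have "Q_const c q \<gamma> = norm_q (domain c) q * (2 * max 1 \<gamma>)"
      by (cases c) auto
    then show ?thesis
      using nonneg mult_left_mono[of 1 "2 * max 1 \<gamma>" "norm_q (domain c) q"] by simp
  qed simp
  have upper: "cmod (F k) \<le> 2 * cmod k * exp (2 * cmod k * \<gamma> + Q_const c q \<gamma>)" if k: "1 \<le> cmod k" for k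
  proof -
    have "jost_value c q k (F k)" using k by (intro val) auto
    then have "cmod (F k) \<le> 2 * cmod k * exp (2 * cmod k * \<gamma> + norm_q (domain c) q)"
      using jost_value_upper_bound q k \<gamma> by blast
    also have "\<dots> \<le> 2 * cmod k * exp (2 * cmod k * \<gamma> + Q_const c q \<gamma>)"
      using Q by (intro mult_left_mono) auto
    finally show ?thesis .
  qed
  have lower: "exp (- \<gamma> - Q_const c q \<gamma>) / 2 \<le> cmod (F 1)"
  proof -
    have "exp (- \<gamma> - Q_const c q \<gamma>) / 2 \<le> exp (- \<gamma> - norm_q (domain c) q) / 2"
      using Q by simp
    also have "\<dots> \<le> cmod (F 1)"
      using jost_value_lower_bound[OF q val \<gamma>] by simp
    finally show ?thesis .
  qed
  \<comment> \<open>The pole and the zero lie on opposite sides of the real line: for $\mathrm{Im}\,k \le 0$ the point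
      $k$ is at least as far from $2i$ as from \<open>0\<close>, and as far as $2i$ is from the real line.\<close>
  have shift: "cmod k \<le> cmod (k - of_real t * \<i>) \<and> \<bar>t\<bar> \<le> cmod (k - of_real t * \<i>)" if "t * Im k \<le> 0" for t k
  proof -
    have "(cmod (k - of_real t * \<i>))\<^sup>2 = (cmod k)\<^sup>2 + t\<^sup>2 - 2 * (t * Im k)"
      unfolding cmod_power2 by (simp add: power2_eq_square algebra_simps)
    then have "(cmod k)\<^sup>2 \<le> (cmod (k - of_real t * \<i>))\<^sup>2" "\<bar>t\<bar>\<^sup>2 \<le> (cmod (k - of_real t * \<i>))\<^sup>2"
      unfolding power2_abs using that zero_le_power2[of t] zero_le_power2[of "cmod k"] by linarith+
    then show ?thesis using power2_le_imp_le norm_ge_zero by blast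
  qed
  have far: "cmod k \<le> cmod (k - 2 * \<i>)" "2 \<le> cmod (k - 2 * \<i>)" if "k \<in> {k. F k = 0 \<and> Im k \<le> 0}" for k
    using shift[of 2 k] that by simp_all
  show "zero_sum_term F (2 * \<i>) p summable_on {k. F k = 0 \<and> Im k \<le> 0}"
    "(\<Sum>\<^sub>\<infinity>k\<in>{k. F k = 0 \<and> Im k \<le> 0}. zero_sum_term F (2 * \<i>) p k)
       \<le> 32 * Y_const p * (1 + \<gamma> / pi + Q_const c q \<gamma>)"
    using zero_sum_bound[OF holo \<gamma>(1) order_trans[OF nonneg Q] upper lower far p] by blast+
  have far': "cmod k \<le> cmod (k - - 2 * \<i>)" "2 \<le> cmod (k - - 2 * \<i>)" if "k \<in> {k. F k = 0 \<and> Im k \<ge> 0}" for k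
    using shift[of "- 2" k] that by simp_all
  show "zero_sum_term F (- 2 * \<i>) p summable_on {k. F k = 0 \<and> Im k \<ge> 0}"
    "(\<Sum>\<^sub>\<infinity>k\<in>{k. F k = 0 \<and> Im k \<ge> 0}. zero_sum_term F (- 2 * \<i>) p k)
       \<le> 32 * Y_const p * (1 + \<gamma> / pi + Q_const c q \<gamma>)"
    using zero_sum_bound[OF holo \<gamma>(1) order_trans[OF nonneg Q] upper lower far' p] by blast+
qed simp

end
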